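(* Let $\mathcal U^{(I)}=\{\mathcal U^{(I)}_N\}$ and $\mathcal U^{(II)}=\{\mathcal U^{(II)}_N\}$ be two sequences of real-valued test statistics, rejecting for large values, for testing $\mathbb H_0: P\times Q\in\mathbb P_0$ against $\mathbb H_1:P\times Q\in\mathbb P_1=\mathbb P\setminus\mathbb P_0$. Let $\rho\in[1,2]$ and assume that $\mathcal U^{(I)}$ satisfies: (I.1) there is a number $c_{\mathcal U^{(I)}}>0$ such that for every sequence $w_N>0$ with $w_N\to0$ and $Nw_N^2\to\infty$, $$-\lim_{N\to\infty}\frac1{Nw_N^2}\log\sup_{P\times Q\in\mathbb P_0}P^{m(N)}\times Q^{n(N)}\bigl(\mathcal U_N^{(I)}>w_N\sqrt N\bigr)=c_{\mathcal U^{(I)}};$$ (I.2) there is a positive function $b_{\mathcal U^{(I)}}(P_\vartheta\times Q_\vartheta)$, $\vartheta\in(0,1)$, such that for every sequence $\vartheta_N\in(0,1)$ with $\vartheta_N\to0$ and $N\vartheta_N^{\rho}\to\infty$, and every $\epsilon>0$, $$\lim_{N\to\infty}\Pi_{\vartheta_N}^N\left(\left|\frac{\mathcal U_N^{(I)}}{\sqrt{mn/N}\,b_{\mathcal U^{(I)}}(P_{\vartheta_N}\times Q_{\vartheta_N})}-1\right|\ge\epsilon\right)=0,$$ where $m=m(N)$, $n=n(N)$ and $\Pi^N_{\vartheta_N}=P_{\vartheta_N}^{m(N)}\times Q_{\vartheta_N}^{n(N)}$. Let $\{\theta_N\}$ be a particular sequence with $\theta_N\in(0,1)$, $\theta_N\to0$,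 $N\theta_N^{\rho}\to\infty$, and let $\Pi_{\theta_N}^N=P_{\theta_N}^{m(N)}\times Q_{\theta_N}^{n(N)}$, $\pi=\{\Pi_{\theta_N}^N\}$. Assume that $\mathcal U^{(II)}$ satisfies: (II.1) there are sequences $\{\gamma_N\},\{\lambda_N\}$ with $1\le\gamma_N<\lambda_N\le N$, $\gamma_N/\lambda_N\to0$, and a number $c_{\mathcal U^{(II)}}>0$ such that for every positive sequence $w_N$ with $Nw_N^2/\lambda_N\to0$ and $Nw_N^2/\gamma_N\to\infty$, $$-\lim_{N\to\infty}\frac1{Nw_N^2}\log\sup_{P\times Q\in\mathbb P_0}P^{m(N)}\times Q^{n(N)}\bigl(\mathcal U_N^{(II)}>w_N\sqrt N\bigr)=c_{\mathcal U^{(II)}};$$ (II.2) there is a positive sequence $\{b_{\mathcal U^{(II)}}(\Pi^N_{\theta_N})\}$ such that for every $\epsilon>0$, $$\lim_{N\to\infty}\Pi_{\theta_N}^N\left(\left|\frac{\mathcal U_N^{(II)}}{b_{\mathcal U^{(II)}}(\Pi_{\theta_N}^N)}-1\right|\ge\epsilon\right)=0 .$$ Suppose that there exists $\{\alpha_N\}\in\mathbb L^*(\pi)$ such that $$\lim_{N\to\infty}\frac{\log\alpha_N}{\lambda_N}=0\quad\text{and}\quad\lim_{N\to\infty}\frac{\log\alpha_N}{\gamma_N}=-\infty .$$ Finally, assume that the following limit exists: $$\lim_{N\to\infty}\frac{c_{\mathcal U^{(II)}}[b_{\mathcal U^{(II)}}(\Pi_{\theta_N}^N)]^2}{c_{\mathcal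 U^{(I)}}\,(mn/N)\,[b_{\mathcal U^{(I)}}(P_{\theta_N}\times Q_{\theta_N})]^2}=\mathbf e\in[0,\infty].$$ Then the asymptotic intermediate efficiency $e_{\mathcal U^{(II)}\mathcal U^{(I)}}$ of $\mathcal U^{(II)}$ with respect to $\mathcal U^{(I)}$, under the sequence of alternatives $\{P_{\theta_N}\times Q_{\theta_N}\}$, exists and $e_{\mathcal U^{(II)}\mathcal U^{(I)}}=\mathbf e$.
   Context: Setting. $X_1,\dots,X_m$ and $Y_1,\dots,Y_n$ are two independent samples of i.i.d. observations on the same measurable space, from probability distributions $P$ and $Q$ respectively ($P=Q$ corresponds to the one-sample case). Here $m=m(N)$, $n=n(N)$, $m+n=N$, and $\eta_N=m(N)/N\to\eta\in(0,1)$ as $N\to\infty$. $\mathbb P$ is the set of all product measures $P\times Q$ under consideration, $\mathbb P_0\subset\mathbb P$, $\mathbb P_1=\mathbb P\setminus\mathbb P_0$. $P^{k}$ denotes the $k$-fold product of $P$. The statistics $\mathcal U^{(I)}_N,\mathcal U^{(II)}_N$ are computed from samples of sizes $m(N),n(N)$. Critical values. For $\alpha\in(0,1)$, $$u^{(I)}_{\alpha N}=\inf\Bigl\{w:\sup_{P\times Q\in\mathbb P_0}P^{m(N)}\times Q^{n(N)}\bigl(\mathcal U_N^{(I)}>w\bigr)\le\alpha\Bigr\},$$ and $u^{(II)}_{\alpha N}$ is defined analogously from $\mathcal U^{(II)}_N$. Alternatives. Fixed measures $P_0\times Q_0\in\mathbb P_0$ and $P_1\times Q_1\in\mathbb P_1$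 are given; for $\vartheta\in(0,1)$, $P_\vartheta=(1-\vartheta)P_0+\vartheta P_1$, $Q_\vartheta=(1-\vartheta)Q_0+\vartheta Q_1$, and it is assumed that $P_\vartheta\times Q_\vartheta\in\mathbb P_1$ for every $\vartheta\in(0,1)$. For the given sequence $\{\theta_N\}$ and any natural number $S$ (total size of an auxiliary sample), $\Pi_{\theta_N}^S=P_{\theta_N}^{m(S)}\times Q_{\theta_N}^{n(S)}$; $\pi=\{\Pi_{\theta_N}^N\}$. Levels. $\mathbb L$ is the set of sequences $\{\alpha_N\}\subset(0,1)$ with $\alpha_N\to0$ and $N^{-1}\log\alpha_N\to0$. $\mathbb L^*=\mathbb L^*(\pi)$ is the set of those $\{\alpha_N\}\in\mathbb L$ for which $$0<\liminf_{N\to\infty}\Pi_{\theta_N}^N\bigl(\mathcal U_N^{(II)}>u^{(II)}_{\alpha_NN}\bigr)\le\limsup_{N\to\infty}\Pi_{\theta_N}^N\bigl(\mathcal U_N^{(II)}>u^{(II)}_{\alpha_NN}\bigr)<1 .$$ Efficiency. For $\{\alpha_N\}\in\mathbb L^*$ and $N\ge1$ put $$M_{\mathcal U^{(II)}\mathcal U^{(I)}}(N,\pi)=\inf\Bigl\{M\ge1:\Pi_{\theta_N}^N\bigl(\mathcal U_N^{(II)}>u^{(II)}_{\alpha_NN}\bigr)\le\Pi_{\theta_N}^{M+k}\bigl(\mathcal U_{M+k}^{(I)}>u^{(I)}_{\alpha_N\,M+k}\bigr)\text{ for all }k\ge0\Bigr\}$$ ($\inf\emptyset=\infty$). If $$e_{\mathcal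 U^{(II)}\mathcal U^{(I)}}=\lim_{N\to\infty}\frac{M_{\mathcal U^{(II)}\mathcal U^{(I)}}(N,\pi)}{N}\in[0,\infty]$$ exists and does not depend on the choice of $\{\alpha_N\}\in\mathbb L^*$, one says that the asymptotic intermediate efficiency of $\mathcal U^{(II)}$ with respect to $\mathcal U^{(I)}$, under $\{P_{\theta_N}\times Q_{\theta_N}\}$, exists and equals $e_{\mathcal U^{(II)}\mathcal U^{(I)}}$. *)

theory Defs
  imports "HOL-Probability.Probability"
begin

text \<open>
  A product measure \<open>P \<times> Q\<close> is represented by the pair \<open>(P, Q)\<close> of its marginals, so the
  models are sets of pairs of probability measures.  The functions \<open>m\<close> and \<open>n\<close> give the two
  sample sizes belonging to a total sample size \<open>N\<close>.
\<close>

definition sample_law ::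
  "(nat \<Rightarrow> nat) \<Rightarrow> (nat \<Rightarrow> nat) \<Rightarrow> 'a measure \<times> 'a measure \<Rightarrow> nat
    \<Rightarrow> ((nat \<Rightarrow> 'a) \<times> (nat \<Rightarrow> 'a)) measure" where
  "sample_law m n PQ N =
     (\<Pi>\<^sub>M i\<in>{..<m N}. fst PQ) \<Otimes>\<^sub>M (\<Pi>\<^sub>M j\<in>{..<n N}. snd PQ)"

type_synonym 'a statistic = "nat \<Rightarrow> (nat \<Rightarrow> 'a) \<times> (nat \<Rightarrow> 'a) \<Rightarrow> real"

definition is_statistic ::
  "'a measure \<Rightarrow> (nat \<Rightarrow> nat) \<Rightarrow> (nat \<Rightarrow> nat) \<Rightarrow> 'a statistic \<Rightarrow> bool" where
  "is_statistic X m n U \<longleftrightarrow> (\<forall>N. U N \<in> borel_measurable (sample_law m n (X, X) N))"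

definition sup_tail ::
  "(nat \<Rightarrow> nat) \<Rightarrow> (nat \<Rightarrow> nat) \<Rightarrow> ('a measure \<times> 'a measure) set \<Rightarrow> 'a statistic
    \<Rightarrow> nat \<Rightarrow> real \<Rightarrow> real" where
  "sup_tail m n PP\<^sub>0 U N w = (SUP PQ\<in>PP\<^sub>0. \<P>(x in sample_law m n PQ N. U N x > w))"

text \<open>The infimum is taken in the extended reals, so that it is \<open>\<infinity>\<close> if no \<open>w\<close> qualifies.\<close>

definition critical_value ::
  "(nat \<Rightarrow> nat) \<Rightarrow> (nat \<Rightarrow> nat) \<Rightarrow> ('a measure \<times> 'a measure) set \<Rightarrow> 'a statistic
    \<Rightarrow> real \<Rightarrow> nat \<Rightarrow> ereal" where
  "critical_value m n PP\<^sub>0 U a N = Inf {ereal w | w. sup_tail m n PP\<^sub>0 U N w \<le> a}"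

definition power_at ::
  "(nat \<Rightarrow> nat) \<Rightarrow> (nat \<Rightarrow> nat) \<Rightarrow> ('a measure \<times> 'a measure) set \<Rightarrow> 'a statistic
    \<Rightarrow> 'a measure \<times> 'a measure \<Rightarrow> real \<Rightarrow> nat \<Rightarrow> real" where
  "power_at m n PP\<^sub>0 U PQ a N =
     \<P>(x in sample_law m n PQ N. ereal (U N x) > critical_value m n PP\<^sub>0 U a N)"

definition mixture :: "real \<Rightarrow> 'a measure \<Rightarrow> 'a measure \<Rightarrow> 'a measure" where
  "mixture t P R = measure_of (space P) (sets P)
     (\<lambda>A. ennreal (1 - t) * emeasure P A + ennreal t * emeasure R A)"

lemma sets_mixture [simp]: "sets (mixture t P R) = sets P"
  by (simp add: mixture_def)

lemma emeasure_mixture: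
  assumes "sets R = sets P" and A: "A \<in> sets P"
  shows "emeasure (mixture t P R) A = ennreal (1 - t) * emeasure P A + ennreal t * emeasure R A"
  unfolding mixture_def
proof (rule emeasure_measure_of_sigma)
  let ?f = "\<lambda>A. ennreal (1 - t) * emeasure P A + ennreal t * emeasure R A"
  show "sigma_algebra (space P) (sets P)" ..
  show "positive (sets P) ?f" by (simp add: positive_def)
  show "countably_additive (sets P) ?f"
  proof (rule countably_additiveI)
    fix B :: "nat \<Rightarrow> 'a set"
    assume B: "range B \<subseteq> sets P" "disjoint_family B"
    have "(\<Sum>i. ?f (B i)) = ennreal (1 - t) * (\<Sum>i. emeasure P (B i))
        + ennreal t * (\<Sum>i. emeasure R (B i))"
      by (simp add: suminf_add[symmetric])
    also have "\<dots> = ?f (\<Union>i. B i)"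
      using B assms(1) by (simp add: suminf_emeasure)
    finally show "(\<Sum>i. ?f (B i)) = ?f (\<Union>i. B i)" .
  qed
  show "A \<in> sets P" by fact
qed

definition alternative ::
  "'a measure \<times> 'a measure \<Rightarrow> 'a measure \<times> 'a measure \<Rightarrow> real \<Rightarrow> 'a measure \<times> 'a measure" where
  "alternative PQ\<^sub>0 PQ\<^sub>1 t =
     (mixture t (fst PQ\<^sub>0) (fst PQ\<^sub>1), mixture t (snd PQ\<^sub>0) (snd PQ\<^sub>1))"

text \<open>
  All sequences are functions on \<^typ>\<open>nat\<close>; their value at index \<open>0\<close> plays no role.  Below,
  \<open>R N\<close> is the pair of measures generating the data at stage \<open>N\<close>.
\<close>

definition levels :: "(nat \<Rightarrow> real) set" where
  "levels = {\<alpha>. (\<forall>N. 0 < \<alpha> N \<and> \<alpha> N < 1) \<and> \<alpha> \<longlonglongrightarrow> 0 \<and> (\<lambda>N. ln (\<alpha> N) / real N) \<longlonglongrightarrow> 0}"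

definition levels_star ::
  "(nat \<Rightarrow> nat) \<Rightarrow> (nat \<Rightarrow> nat) \<Rightarrow> ('a measure \<times> 'a measure) set \<Rightarrow> 'a statistic
    \<Rightarrow> (nat \<Rightarrow> 'a measure \<times> 'a measure) \<Rightarrow> (nat \<Rightarrow> real) set" where
  "levels_star m n PP\<^sub>0 U R = {\<alpha> \<in> levels.
     0 < liminf (\<lambda>N. ereal (power_at m n PP\<^sub>0 U (R N) (\<alpha> N) N)) \<and>
     limsup (\<lambda>N. ereal (power_at m n PP\<^sub>0 U (R N) (\<alpha> N) N)) < 1}"

text \<open>
  The least total sample size from which on \<open>U\<close> is at least as powerful against \<open>R N\<close> as \<open>V\<close> is
  with total sample size \<open>N\<close>, both at level \<open>\<alpha> N\<close>; it is \<open>\<infinity>\<close> if there is no such size.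
\<close>

definition required_size ::
  "(nat \<Rightarrow> nat) \<Rightarrow> (nat \<Rightarrow> nat) \<Rightarrow> ('a measure \<times> 'a measure) set \<Rightarrow> 'a statistic \<Rightarrow> 'a statistic
    \<Rightarrow> (nat \<Rightarrow> 'a measure \<times> 'a measure) \<Rightarrow> (nat \<Rightarrow> real) \<Rightarrow> nat \<Rightarrow> ereal" where
  "required_size m n PP\<^sub>0 V U R \<alpha> N = Inf {ereal (real M) | M. 1 \<le> M \<and>
     (\<forall>k. power_at m n PP\<^sub>0 V (R N) (\<alpha> N) N \<le> power_at m n PP\<^sub>0 U (R N) (\<alpha> N) (M + k))}"

text \<open>
  The efficiency of \<open>V\<close> with respect to \<open>U\<close> exists and equals \<open>e\<close>.  Non-emptiness of the set of
  admissible levels is required because otherwise every \<open>e\<close> would qualify.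
\<close>

definition has_intermediate_efficiency ::
  "(nat \<Rightarrow> nat) \<Rightarrow> (nat \<Rightarrow> nat) \<Rightarrow> ('a measure \<times> 'a measure) set \<Rightarrow> 'a statistic \<Rightarrow> 'a statistic
    \<Rightarrow> (nat \<Rightarrow> 'a measure \<times> 'a measure) \<Rightarrow> ereal \<Rightarrow> bool" where
  "has_intermediate_efficiency m n PP\<^sub>0 V U R e \<longleftrightarrow>
     levels_star m n PP\<^sub>0 V R \<noteq> {} \<and>
     (\<forall>\<alpha>\<in>levels_star m n PP\<^sub>0 V R.
        (\<lambda>N. required_size m n PP\<^sub>0 V U R \<alpha> N / ereal (real N)) \<longlonglongrightarrow> e)"

text \<open>
  Since \<open>ln 0 = 0\<close> for real numbers and \<open>c > 0\<close>, the limit below, just like the one with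
  \<open>ln 0 = -\<infinity>\<close>, forces the suprema to be positive for all large \<open>N\<close>.
\<close>

definition tail_rate ::
  "(nat \<Rightarrow> nat) \<Rightarrow> (nat \<Rightarrow> nat) \<Rightarrow> ('a measure \<times> 'a measure) set \<Rightarrow> 'a statistic
    \<Rightarrow> (nat \<Rightarrow> real) \<Rightarrow> real \<Rightarrow> bool" where
  "tail_rate m n PP\<^sub>0 U w c \<longleftrightarrow>
     (\<lambda>N. - (1 / (real N * (w N)\<^sup>2) * ln (sup_tail m n PP\<^sub>0 U N (w N * sqrt (real N))))) \<longlonglongrightarrow> c"

end

theory Submission
  imports Defs "HOL-Real_Asymp.Real_Asymp"
begin

text \<open>
  Why the efficiency is the limiting ratio \<open>e\<close>.  Let \<open>L = - ln (\<alpha> N)\<close>.  The null tail of a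
  statistic at a threshold \<open>v\<close> behaves like \<open>exp (- c * v\<^sup>2)\<close>, so its critical value at level
  \<open>\<alpha> N\<close> is about \<open>sqrt (L / c)\<close>, while under the alternative the statistic is concentrated at
  a point \<open>b\<close>.  Its power therefore tends to \<open>1\<close> or to \<open>0\<close> according to whether \<open>c * b\<^sup>2\<close>
  exceeds \<open>L\<close> by a fixed factor or falls short of it by one.

  For the second statistic the power is by assumption bounded away from \<open>0\<close> and \<open>1\<close>.  This is
  possible only in perfect balance, which pins down the level: \<open>L\<close> is asymptotic to
  \<open>c\<^sub>I\<^sub>I * (b\<^sub>I\<^sub>I N)\<^sup>2\<close> for every admissible sequence of levels
  (\<open>levels_star_log_asymptotics\<close>).  Its tail asymptotics are given only on a range of
  thresholds; the one level sequence known to belong to this range shows that \<open>b\<^sub>I\<^sub>I\<close> does,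
  and hence all the others do (\<open>concentration_point_in_range\<close>).

  For the first statistic, used with \<open>S\<close> observations against the alternative of stage \<open>N\<close>, the
  concentration point squared is about \<open>\<eta> * (1 - \<eta>) * S * \<beta>\<^sup>2\<close>, where \<open>\<beta>\<close> is the value of
  \<open>b\<^sub>I\<close> at that alternative.  Balance is reached at \<open>S = q * N\<close> with
  \<open>q = L / (c\<^sub>I * \<eta> * (1 - \<eta>) * N * \<beta>\<^sup>2)\<close>, and by the previous paragraph \<open>q\<close> tends to \<open>e\<close>.
  All sizes \<open>S \<ge> A * N\<close> with \<open>A > e\<close> thus have power near \<open>1\<close>, more than the second statistic,
  and a size of about \<open>A * N\<close> with \<open>A < e\<close> has power near \<open>0\<close>, less than the second statistic
  (\<open>power_dichotomy\<close>).  This encloses the required size (\<open>required_size_limit\<close>).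

  The comparison needs the hypotheses on the first statistic uniformly over
  infinitely many sizes \<open>S\<close> for one \<open>N\<close>, although they are stated for sequences with one
  parameter per size; \<open>uniform_of_sequences\<close> supplies the uniformity.
\<close>

section \<open>Sample laws, tails and powers\<close>

definition admissible :: "'a measure \<Rightarrow> 'a measure \<times> 'a measure \<Rightarrow> bool" where
  "admissible X PQ \<longleftrightarrow> prob_space (fst PQ) \<and> prob_space (snd PQ) \<and>
     sets (fst PQ) = sets X \<and> sets (snd PQ) = sets X"

lemma prob_space_sample_law:
  assumes "admissible X PQ"
  shows "prob_space (sample_law m n PQ N)"
proof -
  have P: "prob_space (fst PQ)" and Q: "prob_space (snd PQ)"
    using assms by (auto simp: admissible_def)
  interpret A: prob_space "\<Pi>\<^sub>M i\<in>{..<m N}. fst PQ" by (intro prob_space_PiM P)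
  interpret B: prob_space "\<Pi>\<^sub>M j\<in>{..<n N}. snd PQ" by (intro prob_space_PiM Q)
  interpret pair_prob_space "\<Pi>\<^sub>M i\<in>{..<m N}. fst PQ" "\<Pi>\<^sub>M j\<in>{..<n N}. snd PQ" ..
  show ?thesis unfolding sample_law_def by (rule P.prob_space_axioms)
qed

lemma statistic_measurable:
  assumes "is_statistic X m n U" "admissible X PQ"
  shows "U N \<in> borel_measurable (sample_law m n PQ N)"
proof -
  have "sets (sample_law m n PQ N) = sets (sample_law m n (X, X) N)"
    unfolding sample_law_def using assms(2)
    by (intro sets_pair_measure_cong sets_PiM_cong) (auto simp: admissible_def)
  then show ?thesis
    using assms(1) by (simp add: is_statistic_def cong: measurable_cong_sets)
qed

locale test_statistic =
  fixes X :: "'a measure" and m n :: "nat \<Rightarrow> nat"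
    and PP\<^sub>0 :: "('a measure \<times> 'a measure) set" and U :: "'a statistic"
  assumes null_nonempty: "PP\<^sub>0 \<noteq> {}"
    and null_admissible: "\<And>PQ. PQ \<in> PP\<^sub>0 \<Longrightarrow> admissible X PQ"
    and statistic: "is_statistic X m n U"
begin

abbreviation tail_at :: "nat \<Rightarrow> real \<Rightarrow> real" where
  "tail_at \<equiv> sup_tail m n PP\<^sub>0 U"

abbreviation power :: "'a measure \<times> 'a measure \<Rightarrow> real \<Rightarrow> nat \<Rightarrow> real" where
  "power \<equiv> power_at m n PP\<^sub>0 U"

abbreviation deviation :: "'a measure \<times> 'a measure \<Rightarrow> real \<Rightarrow> real \<Rightarrow> nat \<Rightarrow> real" where
  "deviation R b \<epsilon> N \<equiv> \<P>(x in sample_law m n R N. \<bar>U N x / b - 1\<bar> \<ge> \<epsilon>)"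

lemma measurable_U:
  "admissible X R \<Longrightarrow> U N \<in> borel_measurable (sample_law m n R N)"
  using statistic by (rule statistic_measurable)

lemma tail_prob_le_1:
  assumes "PQ \<in> PP\<^sub>0"
  shows "\<P>(x in sample_law m n PQ N. U N x > w) \<le> 1"
proof -
  interpret prob_space "sample_law m n PQ N"
    by (rule prob_space_sample_law[OF null_admissible[OF assms]])
  show ?thesis by (rule prob_le_1)
qed

lemma tail_bdd_above:
  "bdd_above ((\<lambda>PQ. \<P>(x in sample_law m n PQ N. U N x > w)) ` PP\<^sub>0)"
  using tail_prob_le_1 by (auto intro!: bdd_aboveI[of _ 1])

lemma tail_nonneg: "0 \<le> tail_at N w"
proof -
  obtain PQ where "PQ \<in> PP\<^sub>0" using null_nonempty by auto
  then show ?thesis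
    unfolding sup_tail_def by (intro cSUP_upper2[OF tail_bdd_above]) auto
qed

lemma tail_antimono:
  assumes "v \<le> w"
  shows "tail_at N w \<le> tail_at N v"
  unfolding sup_tail_def
proof (rule cSUP_mono[OF null_nonempty tail_bdd_above])
  fix PQ assume PQ: "PQ \<in> PP\<^sub>0"
  interpret prob_space "sample_law m n PQ N"
    by (rule prob_space_sample_law[OF null_admissible[OF PQ]])
  note [measurable] = measurable_U[OF null_admissible[OF PQ], of N]
  have "\<P>(x in sample_law m n PQ N. U N x > w) \<le> \<P>(x in sample_law m n PQ N. U N x > v)"
    using assms by (intro finite_measure_mono) auto
  then show "\<exists>PQ'\<in>PP\<^sub>0. \<P>(x in sample_law m n PQ N. U N x > w)
      \<le> \<P>(x in sample_law m n PQ' N. U N x > v)"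
    using PQ by blast
qed

text \<open>
  The critical value enters the whole argument only through the next two lemmas: whether a
  threshold \<open>w\<close> lies above or below it is read off from the null tail at \<open>w\<close>, and \<open>U\<close> can lie on
  the wrong side of \<open>w\<close> only by deviating from \<open>b\<close> by the relative amount \<open>\<epsilon>\<close>.
\<close>

lemma power_le_deviation:
  assumes R: "admissible X R" and "a < tail_at N w" and b: "b > 0" and w: "(1 + \<epsilon>) * b \<le> w"
  shows "power R a N \<le> deviation R b \<epsilon> N"
proof -
  interpret prob_space "sample_law m n R N" by (rule prob_space_sample_law[OF R])
  note [measurable] = measurable_U[OF R, of N]
  have "ereal w \<le> critical_value m n PP\<^sub>0 U a N"
    unfolding critical_value_def
  proof (rule Inf_greatest, clarify)
    fix v assume "tail_at N v \<le> a"
    then have "\<not> v \<le> w" using tail_antimono[of v w N] assms(2) by auto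
    then show "ereal w \<le> ereal v" by simp
  qed
  moreover have "\<epsilon> \<le> \<bar>u / b - 1\<bar>" if "w < u" for u
  proof -
    have "(1 + \<epsilon>) * b < u" using w that by simp
    then have "1 + \<epsilon> < u / b" using b by (simp add: pos_less_divide_eq)
    then show ?thesis by simp
  qed
  ultimately show ?thesis
    unfolding power_at_def
    by (intro finite_measure_mono) (auto dest: order.strict_trans1)
qed

lemma power_ge_deviation:
  assumes R: "admissible X R" and "tail_at N w \<le> a" and b: "b > 0" and w: "w \<le> (1 - \<epsilon>) * b"
  shows "1 - deviation R b \<epsilon> N \<le> power R a N"
proof -
  interpret prob_space "sample_law m n R N" by (rule prob_space_sample_law[OF R])
  note [measurable] = measurable_U[OF R, of N]
  have "critical_value m n PP\<^sub>0 U a N \<le> ereal w"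
    unfolding critical_value_def using assms(2) by (auto intro: Inf_lower)
  moreover have "w < u" if "\<not> \<epsilon> \<le> \<bar>u / b - 1\<bar>" for u
  proof -
    have "1 - \<epsilon> < u / b" using that by simp
    then show ?thesis using w b by (simp add: pos_less_divide_eq)
  qed
  ultimately have "\<P>(x in sample_law m n R N. \<not> \<epsilon> \<le> \<bar>U N x / b - 1\<bar>) \<le> power R a N"
    unfolding power_at_def
    by (intro finite_measure_mono) (auto intro: order.strict_trans1)
  then show ?thesis by (subst (asm) prob_neg) auto
qed

end

lemma le_of_neg_ln_ge:
  fixes a s :: real
  assumes "0 < a" "0 \<le> s" "- ln a \<le> - ln s"
  shows "s \<le> a"
  using assms by (cases "s = 0") auto

text \<open>Positivity of \<open>- ln s\<close> excludes \<open>s = 0\<close>, where \<open>ln\<close> takes the default value \<open>0\<close>.\<close>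

lemma less_of_neg_ln_less:
  fixes a s :: real
  assumes "0 < a" "0 \<le> s" "0 < - ln s" "- ln s < - ln a"
  shows "a < s"
  using assms by (cases "s = 0") auto

section \<open>Levels with non-degenerate power\<close>

context test_statistic
begin

text \<open>
  A power staying away from \<open>0\<close> and \<open>1\<close> forces the critical value to be asymptotically equal to
  \<open>b N\<close>: otherwise, \<open>U\<close> being concentrated at \<open>b N\<close>, the power would approach \<open>0\<close> or \<open>1\<close> along a
  subsequence.  In terms of tails, the level separates the tails at \<open>k * b N\<close> with \<open>k > 1\<close> from
  those with \<open>k < 1\<close>.
\<close>

lemma levels_star_tail:
  assumes R: "\<And>N. admissible X (R N)" and b: "\<And>N. b N > 0"
    and dev: "\<And>\<epsilon>. \<epsilon> > 0 \<Longrightarrow> (\<lambda>N. deviation (R N) (b N) \<epsilon> N) \<longlonglongrightarrow> 0"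
    and \<alpha>: "\<alpha> \<in> levels_star m n PP\<^sub>0 U R"
  shows levels_star_tail_le: "k > 1 \<Longrightarrow> \<forall>\<^sub>F N in sequentially. tail_at N (k * b N) \<le> \<alpha> N"
    and levels_star_tail_gr: "k < 1 \<Longrightarrow> \<forall>\<^sub>F N in sequentially. \<alpha> N < tail_at N (k * b N)"
proof -
  assume k: "k > 1"
  have "0 < liminf (\<lambda>N. ereal (power (R N) (\<alpha> N) N))"
    using \<alpha> by (simp add: levels_star_def)
  then obtain \<delta> where \<delta>: "0 < ereal \<delta>" "ereal \<delta> < liminf (\<lambda>N. ereal (power (R N) (\<alpha> N) N))"
    using ereal_dense2 by blast
  have "\<forall>\<^sub>F N in sequentially. ereal \<delta> < ereal (power (R N) (\<alpha> N) N)"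
    by (rule less_LiminfD[OF \<delta>(2)])
  moreover have "\<forall>\<^sub>F N in sequentially. deviation (R N) (b N) (k - 1) N < \<delta>"
    using k \<delta>(1) by (intro order_tendstoD(2)[OF dev]) auto
  ultimately show "\<forall>\<^sub>F N in sequentially. tail_at N (k * b N) \<le> \<alpha> N"
  proof eventually_elim
    case (elim N)
    show ?case
    proof (rule ccontr)
      assume "\<not> ?case"
      then have "power (R N) (\<alpha> N) N \<le> deviation (R N) (b N) (k - 1) N"
        by (intro power_le_deviation[OF R _ b]) auto
      with elim show False by simp
    qed
  qed
next
  assume k: "k < 1"
  have "limsup (\<lambda>N. ereal (power (R N) (\<alpha> N) N)) < 1"
    using \<alpha> by (simp add: levels_star_def)
  then obtain \<delta> where \<delta>: "limsup (\<lambda>N. ereal (power (R N) (\<alpha> N) N)) < ereal \<delta>" "ereal \<delta> < 1"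
    using ereal_dense2 by blast
  have "\<forall>\<^sub>F N in sequentially. ereal (power (R N) (\<alpha> N) N) < ereal \<delta>"
    by (rule Limsup_lessD[OF \<delta>(1)])
  moreover have "\<forall>\<^sub>F N in sequentially. deviation (R N) (b N) (1 - k) N < 1 - \<delta>"
    using k \<delta>(2) by (intro order_tendstoD(2)[OF dev]) auto
  ultimately show "\<forall>\<^sub>F N in sequentially. \<alpha> N < tail_at N (k * b N)"
  proof eventually_elim
    case (elim N)
    show ?case
    proof (rule ccontr)
      assume "\<not> ?case"
      then have "1 - deviation (R N) (b N) (1 - k) N \<le> power (R N) (\<alpha> N) N"
        by (intro power_ge_deviation[OF R _ b]) auto
      with elim show False by simp
    qed
  qed
qed

text \<open>
  The restriction of the tail asymptotics to thresholds between \<open>\<gamma>\<close> and \<open>\<Lambda>\<close> is met by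
  multiples of \<open>sqrt (- ln (\<alpha> N))\<close> for the level \<open>\<alpha>\<close> supplied.  Comparing these
  multiples with those of \<open>b N\<close> carries the restriction over to \<open>b\<close>, after which no reference to
  that particular level remains.
\<close>

lemma concentration_point_in_range:
  fixes \<gamma> \<Lambda> :: "nat \<Rightarrow> real" and c :: real
  assumes R: "\<And>N. admissible X (R N)" and b: "\<And>N. b N > 0"
    and dev: "\<And>\<epsilon>. \<epsilon> > 0 \<Longrightarrow> (\<lambda>N. deviation (R N) (b N) \<epsilon> N) \<longlonglongrightarrow> 0"
    and c: "c > 0"
    and tail: "\<And>v. (\<And>N. v N > 0) \<Longrightarrow> (\<lambda>N. (v N)\<^sup>2 / \<Lambda> N) \<longlonglongrightarrow> 0 \<Longrightarrow>
        filterlim (\<lambda>N. (v N)\<^sup>2 / \<gamma> N) at_top sequentially \<Longrightarrow>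
        (\<lambda>N. - ln (tail_at N (v N)) / (v N)\<^sup>2) \<longlonglongrightarrow> c"
    and pos: "\<forall>\<^sub>F N in sequentially. 0 < \<gamma> N \<and> 0 < \<Lambda> N"
    and \<alpha>: "\<alpha> \<in> levels_star m n PP\<^sub>0 U R"
    and \<alpha>_range: "(\<lambda>N. ln (\<alpha> N) / \<Lambda> N) \<longlonglongrightarrow> 0"
      "filterlim (\<lambda>N. ln (\<alpha> N) / \<gamma> N) at_bot sequentially"
    and \<kappa>: "\<kappa> > 0"
  shows "(\<lambda>N. (\<kappa> * b N)\<^sup>2 / \<Lambda> N) \<longlonglongrightarrow> 0"
    and "filterlim (\<lambda>N. (\<kappa> * b N)\<^sup>2 / \<gamma> N) at_top sequentially"
proof -
  define L where "L N = - ln (\<alpha> N)" for N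
  have \<alpha>01: "0 < \<alpha> N" "\<alpha> N < 1" for N
    using \<alpha> by (auto simp: levels_star_def levels_def)
  then have L: "L N > 0" for N by (simp add: L_def)
  have L\<Lambda>: "(\<lambda>N. a * (L N / \<Lambda> N)) \<longlonglongrightarrow> 0" for a
    using tendsto_mult_right_zero[OF tendsto_minus[OF \<alpha>_range(1), simplified], of a]
    by (simp add: L_def)
  have L\<gamma>: "filterlim (\<lambda>N. a * (L N / \<gamma> N)) at_top sequentially" if "a > 0" for a
  proof -
    have "filterlim (\<lambda>N. L N / \<gamma> N) at_top sequentially"
      using \<alpha>_range(2) by (simp add: filterlim_uminus_at_top L_def)
    then show ?thesis
      by (rule filterlim_tendsto_pos_mult_at_top[OF tendsto_const that])
  qed
  have rate: "(\<lambda>N. - ln (tail_at N (sqrt (a * L N))) / L N) \<longlonglongrightarrow> c * a" if a: "a > 0" for a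
  proof -
    have "(\<lambda>N. - ln (tail_at N (sqrt (a * L N))) / (sqrt (a * L N))\<^sup>2) \<longlonglongrightarrow> c"
      using a L L\<Lambda> L\<gamma>[OF a] by (intro tail) (auto simp: less_imp_le)
    then have "(\<lambda>N. - ln (tail_at N (sqrt (a * L N))) / (sqrt (a * L N))\<^sup>2 * a) \<longlonglongrightarrow> c * a"
      by (intro tendsto_intros)
    moreover have "- ln (tail_at N (sqrt (a * L N))) / (sqrt (a * L N))\<^sup>2 * a
        = - ln (tail_at N (sqrt (a * L N))) / L N" for N
      using a L[of N] by (simp add: less_imp_le)
    ultimately show ?thesis by simp
  qed
  \<comment> \<open>The null tail is about \<open>exp (- 2 * L N)\<close> at \<open>sqrt (2 / c * L N)\<close>, below the level, and about
      \<open>exp (- L N / 2)\<close> at \<open>sqrt (1 / (2 * c) * L N)\<close>, above the level.\<close>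
  have "\<forall>\<^sub>F N in sequentially. 1 < - ln (tail_at N (sqrt (2 / c * L N))) / L N"
    using c by (intro order_tendstoD(1)[OF rate]) auto
  moreover have "\<forall>\<^sub>F N in sequentially. \<alpha> N < tail_at N (1 / 2 * b N)"
    by (rule levels_star_tail_gr[OF R b dev \<alpha>]) auto
  ultimately have upper: "\<forall>\<^sub>F N in sequentially. (b N)\<^sup>2 \<le> 8 / c * L N"
  proof eventually_elim
    case (elim N)
    have "L N < - ln (tail_at N (sqrt (2 / c * L N)))"
      using elim(1) unfolding pos_less_divide_eq[OF L] by simp
    then have "tail_at N (sqrt (2 / c * L N)) \<le> \<alpha> N"
      by (intro le_of_neg_ln_ge[OF \<alpha>01(1) tail_nonneg]) (use L_def[of N] in linarith)
    then have "\<not> sqrt (2 / c * L N) \<le> 1 / 2 * b N"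
      using elim(2) tail_antimono[of "sqrt (2 / c * L N)" "1 / 2 * b N" N] by linarith
    then have "b N \<le> 2 * sqrt (2 / c * L N)" by simp
    then have "(b N)\<^sup>2 \<le> (2 * sqrt (2 / c * L N))\<^sup>2"
      using b[of N] by (intro power_mono) auto
    then show ?case using c L[of N] by (simp add: power_mult_distrib)
  qed
  have "\<forall>\<^sub>F N in sequentially. 0 < - ln (tail_at N (sqrt (1 / (2 * c) * L N))) / L N"
    using c by (intro order_tendstoD(1)[OF rate]) auto
  moreover have "\<forall>\<^sub>F N in sequentially. - ln (tail_at N (sqrt (1 / (2 * c) * L N))) / L N < 1"
    using c by (intro order_tendstoD(2)[OF rate]) auto
  moreover have "\<forall>\<^sub>F N in sequentially. tail_at N (2 * b N) \<le> \<alpha> N"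
    by (rule levels_star_tail_le[OF R b dev \<alpha>]) auto
  ultimately have lower: "\<forall>\<^sub>F N in sequentially. 1 / (8 * c) * L N \<le> (b N)\<^sup>2"
  proof eventually_elim
    case (elim N)
    have "0 < - ln (tail_at N (sqrt (1 / (2 * c) * L N)))"
      "- ln (tail_at N (sqrt (1 / (2 * c) * L N))) < L N"
      using elim(1,2) unfolding pos_less_divide_eq[OF L] pos_divide_less_eq[OF L] by simp_all
    then have "\<alpha> N < tail_at N (sqrt (1 / (2 * c) * L N))"
      by (intro less_of_neg_ln_less[OF \<alpha>01(1) tail_nonneg]) (use L_def[of N] in linarith)+
    then have "\<not> 2 * b N \<le> sqrt (1 / (2 * c) * L N)"
      using elim(3) tail_antimono[of "2 * b N" "sqrt (1 / (2 * c) * L N)" N] by linarith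
    then have "sqrt (1 / (2 * c) * L N) \<le> 2 * b N" by simp
    then have "(sqrt (1 / (2 * c) * L N))\<^sup>2 \<le> (2 * b N)\<^sup>2"
      using c L[of N] by (intro power_mono) (auto simp: less_imp_le)
    then show ?case using c L[of N] by (simp add: power_mult_distrib field_simps)
  qed
  show "(\<lambda>N. (\<kappa> * b N)\<^sup>2 / \<Lambda> N) \<longlonglongrightarrow> 0"
  proof (rule tendsto_sandwich[OF _ _ tendsto_const L\<Lambda>])
    show "\<forall>\<^sub>F N in sequentially. 0 \<le> (\<kappa> * b N)\<^sup>2 / \<Lambda> N"
      using pos by eventually_elim simp
    show "\<forall>\<^sub>F N in sequentially. (\<kappa> * b N)\<^sup>2 / \<Lambda> N \<le> \<kappa>\<^sup>2 * (8 / c) * (L N / \<Lambda> N)"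
      using pos upper
    proof eventually_elim
      case (elim N)
      then have "(\<kappa> * b N)\<^sup>2 \<le> \<kappa>\<^sup>2 * (8 / c * L N)"
        unfolding power_mult_distrib by (intro mult_left_mono) auto
      then have "(\<kappa> * b N)\<^sup>2 / \<Lambda> N \<le> \<kappa>\<^sup>2 * (8 / c * L N) / \<Lambda> N"
        using elim by (intro divide_right_mono) auto
      then show ?case by (simp add: mult.assoc)
    qed
  qed
  show "filterlim (\<lambda>N. (\<kappa> * b N)\<^sup>2 / \<gamma> N) at_top sequentially"
  proof (rule filterlim_at_top_mono)
    show "filterlim (\<lambda>N. \<kappa>\<^sup>2 * (1 / (8 * c)) * (L N / \<gamma> N)) at_top sequentially"
      using \<kappa> c by (intro L\<gamma>) auto
    show "\<forall>\<^sub>F N in sequentially. \<kappa>\<^sup>2 * (1 / (8 * c)) * (L N / \<gamma> N) \<le> (\<kappa> * b N)\<^sup>2 / \<gamma> N"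
      using pos lower
    proof eventually_elim
      case (elim N)
      then have "\<kappa>\<^sup>2 * (1 / (8 * c) * L N) \<le> (\<kappa> * b N)\<^sup>2"
        unfolding power_mult_distrib by (intro mult_left_mono) auto
      then have "\<kappa>\<^sup>2 * (1 / (8 * c) * L N) / \<gamma> N \<le> (\<kappa> * b N)\<^sup>2 / \<gamma> N"
        using elim by (intro divide_right_mono) auto
      then show ?case by (simp add: mult.assoc)
    qed
  qed
qed

text \<open>
  All admissible levels therefore have the same logarithmic order: the critical value is
  asymptotically \<open>b N\<close>, and the null tail there is \<open>exp (- c * (b N)\<^sup>2)\<close> up to a factor
  \<open>1 + o(1)\<close> in the exponent.
\<close>

lemma levels_star_log_asymptotics:
  fixes c :: real
  assumes R: "\<And>N. admissible X (R N)" and b: "\<And>N. b N > 0"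
    and dev: "\<And>\<epsilon>. \<epsilon> > 0 \<Longrightarrow> (\<lambda>N. deviation (R N) (b N) \<epsilon> N) \<longlonglongrightarrow> 0"
    and c: "c > 0"
    and tail: "\<And>\<kappa>. \<kappa> > 0 \<Longrightarrow> (\<lambda>N. - ln (tail_at N (\<kappa> * b N)) / (\<kappa> * b N)\<^sup>2) \<longlonglongrightarrow> c"
    and \<alpha>: "\<alpha> \<in> levels_star m n PP\<^sub>0 U R"
  shows "(\<lambda>N. - ln (\<alpha> N) / (b N)\<^sup>2) \<longlonglongrightarrow> c"
proof -
  have \<alpha>01: "0 < \<alpha> N" "\<alpha> N < 1" for N
    using \<alpha> by (auto simp: levels_star_def levels_def)
  \<comment> \<open>Scaling by \<open>sqrt k\<close> makes the limit linear in \<open>k\<close>, so it is easily placed halfway between \<open>a\<close> and \<open>c\<close>.\<close>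
  have rate: "(\<lambda>N. - ln (tail_at N (sqrt k * b N)) / (b N)\<^sup>2) \<longlonglongrightarrow> c * k" if k: "k > 0" for k
  proof -
    have "(\<lambda>N. - ln (tail_at N (sqrt k * b N)) / (sqrt k * b N)\<^sup>2 * k) \<longlonglongrightarrow> c * k"
      using k by (intro tendsto_intros tail) auto
    moreover have "- ln (tail_at N (sqrt k * b N)) / (sqrt k * b N)\<^sup>2 * k
        = - ln (tail_at N (sqrt k * b N)) / (b N)\<^sup>2" for N
      using k b[of N] by (simp add: power_mult_distrib)
    ultimately show ?thesis by simp
  qed
  show ?thesis
  proof (rule order_tendstoI)
    fix a assume a: "c < a"
    define k where "k = (a + c) / (2 * c)"
    have "c * k = (a + c) / 2" using c by (simp add: k_def)
    moreover have "k > 1" using a c by (simp add: k_def)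
    ultimately have k: "k > 1" "0 < c * k" "c * k < a"
      using a c by auto
    have "\<forall>\<^sub>F N in sequentially. 0 < - ln (tail_at N (sqrt k * b N)) / (b N)\<^sup>2"
      using k by (intro order_tendstoD(1)[OF rate]) auto
    moreover have "\<forall>\<^sub>F N in sequentially. - ln (tail_at N (sqrt k * b N)) / (b N)\<^sup>2 < a"
      using k by (intro order_tendstoD(2)[OF rate]) auto
    moreover have "\<forall>\<^sub>F N in sequentially. tail_at N (sqrt k * b N) \<le> \<alpha> N"
      using k by (intro levels_star_tail_le[OF R b dev \<alpha>]) auto
    ultimately show "\<forall>\<^sub>F N in sequentially. - ln (\<alpha> N) / (b N)\<^sup>2 < a"
    proof eventually_elim
      case (elim N)
      have "tail_at N (sqrt k * b N) \<noteq> 0" using elim(1) by auto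
      then have "0 < tail_at N (sqrt k * b N)" using tail_nonneg[of N "sqrt k * b N"] by simp
      then have "- ln (\<alpha> N) \<le> - ln (tail_at N (sqrt k * b N))"
        using elim(3) by simp
      then have "- ln (\<alpha> N) / (b N)\<^sup>2 \<le> - ln (tail_at N (sqrt k * b N)) / (b N)\<^sup>2"
        by (rule divide_right_mono) simp
      with elim(2) show ?case by simp
    qed
  next
    fix a assume a: "a < c"
    \<comment> \<open>The maximum keeps \<open>k\<close> positive when \<open>a\<close> is very negative.\<close>
    define k where "k = (max a 0 + c) / (2 * c)"
    have k: "0 < k" "k < 1" "a < c * k"
      using a c by (auto simp: k_def field_simps max_def)
    have "\<forall>\<^sub>F N in sequentially. a < - ln (tail_at N (sqrt k * b N)) / (b N)\<^sup>2"
      using k by (intro order_tendstoD(1)[OF rate]) auto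
    moreover have "\<forall>\<^sub>F N in sequentially. \<alpha> N < tail_at N (sqrt k * b N)"
      using k by (intro levels_star_tail_gr[OF R b dev \<alpha>]) auto
    ultimately show "\<forall>\<^sub>F N in sequentially. a < - ln (\<alpha> N) / (b N)\<^sup>2"
    proof eventually_elim
      case (elim N)
      then have "- ln (tail_at N (sqrt k * b N)) \<le> - ln (\<alpha> N)"
        using \<alpha>01[of N] by simp
      then have "- ln (tail_at N (sqrt k * b N)) / (b N)\<^sup>2 \<le> - ln (\<alpha> N) / (b N)\<^sup>2"
        by (rule divide_right_mono) simp
      with elim(1) show ?case by simp
    qed
  qed
qed

end

section \<open>Uniformity over sample sizes\<close>

text \<open>
  The hypotheses on the first statistic speak of one parameter per sample size, whereas the
  comparison of sample sizes needs the same parameter at many sizes.  A convergence that holds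
  along all such sequences is uniform: counterexamples to uniformity with bounds getting worse
  could be collected into a single sequence, each placed at the index given by its sample size.
  Indices without a counterexample are filled with \<open>(N + 2) powr - (1 / 4)\<close>, which satisfies the
  growth condition because \<open>\<rho> \<le> 2\<close>.
\<close>

lemma uniform_of_sequences:
  fixes F :: "nat \<Rightarrow> real \<Rightarrow> real"
  assumes \<rho>: "0 \<le> \<rho>" "\<rho> \<le> 2" and "\<delta> > 0"
    and lim: "\<And>t. (\<And>N. 0 < t N \<and> t N < 1) \<Longrightarrow> t \<longlonglongrightarrow> 0 \<Longrightarrow>
        filterlim (\<lambda>N. real N * t N powr \<rho>) at_top sequentially \<Longrightarrow>
        (\<lambda>N. F N (t N)) \<longlonglongrightarrow> l"
  shows "\<exists>\<tau>>0. \<exists>K. \<forall>S t. 0 < t \<longrightarrow> t < \<tau> \<longrightarrow> K \<le> real S * t powr \<rho> \<longrightarrow> \<bar>F S t - l\<bar> < \<delta>"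
proof (rule ccontr)
  assume neg: "\<not> ?thesis"
  have "\<exists>S t. 0 < t \<and> t < 1 / (real k + 2) \<and> real k + 1 \<le> real S * t powr \<rho>
      \<and> \<not> \<bar>F S t - l\<bar> < \<delta>" for k :: nat
  proof -
    have "0 < 1 / (real k + 2)" by simp
    with neg show ?thesis by blast
  qed
  then obtain S t where
    t: "\<And>k. 0 < t k" "\<And>k. t k < 1 / (real k + 2)" and
    St: "\<And>k. real k + 1 \<le> real (S k) * t k powr \<rho>" and
    bad: "\<And>k. \<not> \<bar>F (S k) (t k) - l\<bar> < \<delta>"
    by metis
  have t1: "t k < 1" for k
    using t(2)[of k] by (rule order.strict_trans2) simp
  have S: "k < S k" for k
  proof -
    have "t k powr \<rho> \<le> 1" using t(1)[of k] t1[of k] \<rho> by (simp add: powr_le1)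
    then have "real (S k) * t k powr \<rho> \<le> real (S k) * 1" by (intro mult_left_mono) auto
    then show ?thesis using St[of k] by simp
  qed
  define f where "f N = (real N + 2) powr - (1 / 4)" for N :: nat
  have f: "0 < f N" "f N < 1" for N
    by (auto simp: f_def powr_minus_divide)
  have f_lim: "f \<longlonglongrightarrow> 0" unfolding f_def by real_asymp
  have f_growth: "filterlim (\<lambda>N. real N * f N powr \<rho>) at_top sequentially"
  proof (rule filterlim_at_top_mono)
    show "filterlim (\<lambda>N. real N * (real N + 2) powr - (1 / 2)) at_top sequentially"
      by real_asymp
    have "(real N + 2) powr - (1 / 2) \<le> f N powr \<rho>" for N
    proof -
      have "(real N + 2) powr - (1 / 2) = f N powr 2" by (simp add: f_def powr_powr)
      also have "\<dots> \<le> f N powr \<rho>" using f[of N] \<rho> by (intro powr_mono') auto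
      finally show ?thesis .
    qed
    then show "\<forall>\<^sub>F N in sequentially. real N * (real N + 2) powr - (1 / 2) \<le> real N * f N powr \<rho>"
      by (intro always_eventually allI mult_left_mono) auto
  qed
  \<comment> \<open>Several counterexamples may have the same sample size; any of them will do, since each
      \<open>k\<close> is used for one size only and hence the chosen \<open>k\<close> tends to infinity.\<close>
  define g where "g = inv S"
  define u where "u N = (if N \<in> range S then t (g N) else f N)" for N
  have g: "S (g N) = N" if "N \<in> range S" for N
    unfolding g_def using that by (rule f_inv_into_f)
  have g_large: "\<forall>\<^sub>F N in sequentially. N \<in> range S \<longrightarrow> j < g N" for j
    using eventually_gt_at_top[of "Max (S ` {..j})"]
  proof eventually_elim
    case (elim N)
    show ?case
    proof (rule impI, rule ccontr)
      assume "N \<in> range S" "\<not> j < g N"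
      then have "N \<in> S ` {..j}" using g[of N] by (metis atMost_iff imageI not_less)
      then have "N \<le> Max (S ` {..j})" by (intro Max_ge) auto
      with elim show False by linarith
    qed
  qed
  have u: "0 < u N \<and> u N < 1" for N
    using f t t1 by (auto simp: u_def)
  have u_lim: "u \<longlonglongrightarrow> 0"
  proof (rule order_tendstoI)
    fix a :: real assume "0 < a"
    obtain j :: nat where j: "1 / a < real j" using reals_Archimedean2 by blast
    show "\<forall>\<^sub>F N in sequentially. u N < a"
      using g_large[of j] order_tendstoD(2)[OF f_lim \<open>0 < a\<close>]
    proof eventually_elim
      case (elim N)
      show ?case
      proof (cases "N \<in> range S")
        case True
        then have "1 / a < real (g N) + 2" using elim(1) j by auto
        then have "1 / (real (g N) + 2) < a"
          using \<open>0 < a\<close> by (simp add: field_simps)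
        then show ?thesis using True t(2)[of "g N"] by (simp add: u_def)
      qed (use elim in \<open>simp add: u_def\<close>)
    qed
  next
    fix a :: real assume "a < 0"
    then show "\<forall>\<^sub>F N in sequentially. a < u N"
      using u by (intro always_eventually allI) (meson order.strict_trans)
  qed
  have u_growth: "filterlim (\<lambda>N. real N * u N powr \<rho>) at_top sequentially"
    unfolding filterlim_at_top
  proof
    fix Z :: real
    obtain j :: nat where j: "Z < real j" using reals_Archimedean2 by blast
    have "\<forall>\<^sub>F N in sequentially. Z \<le> real N * f N powr \<rho>"
      using f_growth by (simp add: filterlim_at_top)
    then show "\<forall>\<^sub>F N in sequentially. Z \<le> real N * u N powr \<rho>"
      using g_large[of j]
    proof eventually_elim
      case (elim N)
      show ?case
      proof (cases "N \<in> range S")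
        case True
        then have "Z \<le> real (g N) + 1" using elim(2) j by auto
        also have "\<dots> \<le> real N * u N powr \<rho>"
          using St[of "g N"] g[OF True] True by (simp add: u_def)
        finally show ?thesis .
      qed (use elim in \<open>simp add: u_def\<close>)
    qed
  qed
  have "(\<lambda>N. F N (u N)) \<longlonglongrightarrow> l" by (rule lim[OF u u_lim u_growth])
  then have "\<forall>\<^sub>F N in sequentially. \<bar>F N (u N) - l\<bar> < \<delta>"
    using \<open>\<delta> > 0\<close> by (auto dest!: tendstoD simp: dist_real_def)
  then obtain N\<^sub>0 where N\<^sub>0: "\<And>N. N \<ge> N\<^sub>0 \<Longrightarrow> \<bar>F N (u N) - l\<bar> < \<delta>"
    by (auto simp: eventually_sequentially)
  have "N\<^sub>0 \<le> S N\<^sub>0" using S[of N\<^sub>0] by simp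
  then have "\<bar>F (S N\<^sub>0) (u (S N\<^sub>0)) - l\<bar> < \<delta>" by (rule N\<^sub>0)
  moreover have "F (S N\<^sub>0) (u (S N\<^sub>0)) = F (S (g (S N\<^sub>0))) (t (g (S N\<^sub>0)))"
    by (simp add: u_def g)
  ultimately show False using bad by simp
qed

context test_statistic
begin

text \<open>
  In terms of the threshold \<open>v N = w N * sqrt (real N)\<close> the normalisation of the rate becomes
  \<open>(v N)\<^sup>2\<close>.  The value \<open>1\<close> keeps \<open>w\<close> positive at \<open>N = 0\<close>, where the quotient is \<open>0\<close>.
\<close>

lemma tail_rate_threshold:
  assumes v: "\<And>N. v N > 0"
    and rate: "tail_rate m n PP\<^sub>0 U (\<lambda>N. if N = 0 then 1 else v N / sqrt (real N)) c"
  shows "(\<lambda>N. - ln (tail_at N (v N)) / (v N)\<^sup>2) \<longlonglongrightarrow> c"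
proof (rule Lim_transform_eventually[OF rate[unfolded tail_rate_def]])
  show "\<forall>\<^sub>F N in sequentially.
      - (1 / (real N * (if N = 0 then 1 else v N / sqrt (real N))\<^sup>2) *
          ln (tail_at N ((if N = 0 then 1 else v N / sqrt (real N)) * sqrt (real N))))
      = - ln (tail_at N (v N)) / (v N)\<^sup>2"
    using eventually_gt_at_top[of 0]
    by eventually_elim (simp add: power_divide)
qed

lemma uniform_tail_rate:
  assumes rate: "\<And>w. (\<And>N. w N > 0) \<Longrightarrow> w \<longlonglongrightarrow> 0 \<Longrightarrow>
        filterlim (\<lambda>N. real N * (w N)\<^sup>2) at_top sequentially \<Longrightarrow> tail_rate m n PP\<^sub>0 U w c"
    and "\<delta> > 0"
  shows "\<exists>\<tau>>0. \<exists>K. \<forall>S v. 0 < v \<longrightarrow> v\<^sup>2 < \<tau> * real S \<longrightarrow> K \<le> v\<^sup>2 \<longrightarrow>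
           \<bar>- ln (tail_at S v) / v\<^sup>2 - c\<bar> < \<delta>"
proof -
  have "\<exists>\<tau>>0. \<exists>K. \<forall>S w. 0 < w \<longrightarrow> w < \<tau> \<longrightarrow> K \<le> real S * w powr 2 \<longrightarrow>
      \<bar>- (1 / (real S * w\<^sup>2) * ln (tail_at S (w * sqrt (real S)))) - c\<bar> < \<delta>"
  proof (rule uniform_of_sequences)
    fix w :: "nat \<Rightarrow> real"
    assume w: "\<And>N. 0 < w N \<and> w N < 1" "w \<longlonglongrightarrow> 0"
      "filterlim (\<lambda>N. real N * w N powr 2) at_top sequentially"
    have "w N powr 2 = (w N)\<^sup>2" for N using w(1)[of N] by (simp add: powr_numeral)
    with w(3) have "filterlim (\<lambda>N. real N * (w N)\<^sup>2) at_top sequentially" by simp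
    then show "(\<lambda>N. - (1 / (real N * (w N)\<^sup>2) *
        ln (tail_at N (w N * sqrt (real N))))) \<longlonglongrightarrow> c"
      using w by (intro rate[unfolded tail_rate_def]) auto
  qed (use \<open>\<delta> > 0\<close> in auto)
  then obtain \<tau> K where \<tau>: "\<tau> > 0" and K: "\<And>S w. 0 < w \<Longrightarrow> w < \<tau> \<Longrightarrow> K \<le> real S * w powr 2 \<Longrightarrow>
      \<bar>- (1 / (real S * w\<^sup>2) * ln (tail_at S (w * sqrt (real S)))) - c\<bar> < \<delta>"
    by blast
  have "\<bar>- ln (tail_at S v) / v\<^sup>2 - c\<bar> < \<delta>"
    if v: "0 < v" "v\<^sup>2 < \<tau>\<^sup>2 * real S" "K \<le> v\<^sup>2" for S v
  proof -
    define w where "w = v / sqrt (real S)"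
    have S: "0 < real S" using v by (cases "S = 0") auto
    have "w\<^sup>2 < \<tau>\<^sup>2" using v(2) S by (simp add: w_def power_divide pos_divide_less_eq)
    then have w: "0 < w" "w < \<tau>"
      using S v(1) \<tau> by (auto simp: w_def intro: power2_less_imp_less)
    have Sw: "real S * w\<^sup>2 = v\<^sup>2" "w * sqrt (real S) = v"
      using S by (auto simp: w_def power_divide)
    then have "K \<le> real S * w powr 2" using v(3) w by (simp add: powr_numeral)
    then show ?thesis using K[OF w, of S] Sw by simp
  qed
  then show ?thesis using \<tau> by (intro exI[of _ "\<tau>\<^sup>2"]) auto
qed

end

section \<open>Comparison of powers\<close>

context test_statistic
begin

text \<open>
  With \<open>L = - ln (\<alpha> N)\<close>, the critical value at size \<open>S\<close> is close to \<open>sqrt (L / c)\<close>, and the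
  statistic is close to \<open>s S * b (\<theta> N)\<close>, where \<open>(s S)\<^sup>2\<close> is about \<open>h * S\<close>.  Whether the test
  rejects is thus decided by comparing \<open>L\<close> with \<open>c * h * S * (b (\<theta> N))\<^sup>2\<close>.  Of the four factors
  in the safety margin \<open>\<zeta> ^ 4\<close>, one absorbs the error in \<open>L / c\<close>, one the error in
  \<open>(s S)\<^sup>2\<close>, and two the error in the statistic, which enters squared.  The bound \<open>B * N \<le> S\<close>
  makes all errors uniform in \<open>S\<close>: it keeps \<open>L / S\<close> small and \<open>S * \<theta> N powr \<rho>\<close> large.
\<close>

lemma power_dichotomy:
  fixes c h \<rho> \<zeta> \<delta> B :: real and s b :: "_ \<Rightarrow> real"
  assumes \<theta>: "\<And>N. 0 < \<theta> N \<and> \<theta> N < 1" "\<theta> \<longlonglongrightarrow> 0"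
      "filterlim (\<lambda>N. real N * \<theta> N powr \<rho>) at_top sequentially"
    and R: "\<And>t. 0 < t \<Longrightarrow> t < 1 \<Longrightarrow> admissible X (R t)"
    and b: "\<And>t. 0 < t \<Longrightarrow> t < 1 \<Longrightarrow> b t > 0"
    and s: "\<And>S. s S \<ge> 0" "(\<lambda>S. (s S)\<^sup>2 / real S) \<longlonglongrightarrow> h"
    and pos: "c > 0" "h > 0" "B > 0" "\<delta> > 0" "\<zeta> > 0"
    and rate: "\<And>w. (\<And>N. w N > 0) \<Longrightarrow> w \<longlonglongrightarrow> 0 \<Longrightarrow>
        filterlim (\<lambda>N. real N * (w N)\<^sup>2) at_top sequentially \<Longrightarrow> tail_rate m n PP\<^sub>0 U w c"
    and dev: "\<And>\<epsilon> \<delta>. \<epsilon> > 0 \<Longrightarrow> \<delta> > 0 \<Longrightarrow> \<exists>\<tau>>0. \<exists>K. \<forall>S t. 0 < t \<longrightarrow> t < \<tau> \<longrightarrow>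
        K \<le> real S * t powr \<rho> \<longrightarrow> \<bar>deviation (R t) (s S * b t) \<epsilon> S - 0\<bar> < \<delta>"
    and \<alpha>: "\<alpha> \<in> levels"
  shows power_near_1: "\<zeta> < 1 \<Longrightarrow> \<forall>\<^sub>F N in sequentially. \<forall>S. B * real N \<le> real S \<longrightarrow>
      - ln (\<alpha> N) \<le> \<zeta> ^ 4 * c * h * real S * (b (\<theta> N))\<^sup>2 \<longrightarrow> 1 - \<delta> < power (R (\<theta> N)) (\<alpha> N) S"
    and power_near_0: "\<zeta> > 1 \<Longrightarrow> \<forall>\<^sub>F N in sequentially. \<forall>S. B * real N \<le> real S \<longrightarrow>
      \<zeta> ^ 4 * c * h * real S * (b (\<theta> N))\<^sup>2 \<le> - ln (\<alpha> N) \<longrightarrow> power (R (\<theta> N)) (\<alpha> N) S < \<delta>"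
proof -
  define L where "L N = - ln (\<alpha> N)" for N
  have \<alpha>01: "0 < \<alpha> N" "\<alpha> N < 1" for N
    using \<alpha> by (auto simp: levels_def)
  then have L: "L N > 0" for N by (simp add: L_def)
  have L_div: "(\<lambda>N. L N / real N) \<longlonglongrightarrow> 0"
    using \<alpha> tendsto_minus[of "\<lambda>N. ln (\<alpha> N) / real N" 0] by (simp add: levels_def L_def)
  have L_top: "filterlim L at_top sequentially"
  proof -
    have "filterlim \<alpha> (at_right 0) sequentially"
      using \<alpha> \<alpha>01 by (auto simp: levels_def filterlim_at intro!: always_eventually less_imp_neq[symmetric])
    then have "filterlim (\<lambda>N. ln (\<alpha> N)) at_bot sequentially"
      by (rule filterlim_compose[OF ln_at_0])
    then show ?thesis by (simp add: L_def filterlim_uminus_at_top)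
  qed
  \<comment> \<open>The null tail at \<open>v N\<close> is about \<open>exp (- L N / \<zeta>)\<close>, hence on a definite side of the level.
      Since \<open>v N\<close> does not depend on \<open>S\<close>, one threshold serves all sizes.\<close>
  define v where "v N = sqrt (L N / (\<zeta> * c))" for N
  have v: "v N > 0" "(v N)\<^sup>2 = L N / (\<zeta> * c)" for N
    using L[of N] pos by (auto simp: v_def less_imp_le)
  have v2: "(v N)\<^sup>2 > 0" for N using v(1)[of N] by simp
  have v_rate: "\<forall>\<^sub>F N in sequentially. \<forall>S. B * real N \<le> real S \<longrightarrow>
      \<bar>- ln (tail_at S (v N)) / (v N)\<^sup>2 - c\<bar> < d" if d: "d > 0" for d
  proof -
    obtain \<tau> K where \<tau>: "\<tau> > 0" and K: "\<And>S v. 0 < v \<Longrightarrow> v\<^sup>2 < \<tau> * real S \<Longrightarrow> K \<le> v\<^sup>2 \<Longrightarrow>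
           \<bar>- ln (tail_at S v) / v\<^sup>2 - c\<bar> < d"
      using uniform_tail_rate[OF rate d] by blast
    have "\<forall>\<^sub>F N in sequentially. L N / real N < \<tau> * B * (\<zeta> * c)"
      using \<tau> pos by (intro order_tendstoD(2)[OF L_div]) auto
    moreover have "\<forall>\<^sub>F N in sequentially. K * (\<zeta> * c) \<le> L N"
      using L_top by (simp add: filterlim_at_top)
    ultimately show ?thesis
      using eventually_gt_at_top[of 0]
    proof eventually_elim
      case (elim N)
      have "L N < \<tau> * (B * real N) * (\<zeta> * c)"
        using elim(1,3) by (simp add: pos_divide_less_eq mult_ac)
      then have "(v N)\<^sup>2 < \<tau> * (B * real N)"
        using pos by (simp add: v(2) pos_divide_less_eq)
      then have "(v N)\<^sup>2 < \<tau> * real S" if "B * real N \<le> real S" for S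
        using \<tau> that by (meson less_le_trans mult_left_mono less_imp_le)
      moreover have "K \<le> (v N)\<^sup>2"
        using elim(2) pos by (simp add: v(2) pos_le_divide_eq)
      ultimately show ?case using K v(1) by blast
    qed
  qed
  have dev_small: "\<forall>\<^sub>F N in sequentially. \<forall>S. B * real N \<le> real S \<longrightarrow>
      deviation (R (\<theta> N)) (s S * b (\<theta> N)) \<epsilon> S < \<delta>" if \<epsilon>: "\<epsilon> > 0" for \<epsilon>
  proof -
    obtain \<tau> K where \<tau>: "\<tau> > 0" and K: "\<And>S t. 0 < t \<Longrightarrow> t < \<tau> \<Longrightarrow> K \<le> real S * t powr \<rho> \<Longrightarrow>
        \<bar>deviation (R t) (s S * b t) \<epsilon> S - 0\<bar> < \<delta>"
      using dev[OF \<epsilon> pos(4)] by blast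
    have "\<forall>\<^sub>F N in sequentially. K / B \<le> real N * \<theta> N powr \<rho>"
      using \<theta>(3) by (simp add: filterlim_at_top)
    moreover have "\<forall>\<^sub>F N in sequentially. \<theta> N < \<tau>"
      by (rule order_tendstoD(2)[OF \<theta>(2) \<tau>])
    ultimately show ?thesis
    proof eventually_elim
      case (elim N)
      show ?case
      proof (intro allI impI)
        fix S assume "B * real N \<le> real S"
        then have "B * real N * \<theta> N powr \<rho> \<le> real S * \<theta> N powr \<rho>"
          by (rule mult_right_mono) simp
        moreover have "K \<le> B * real N * \<theta> N powr \<rho>"
          using elim(1) pos by (simp add: pos_divide_le_eq mult_ac)
        ultimately have "K \<le> real S * \<theta> N powr \<rho>" by linarith
        then have "\<bar>deviation (R (\<theta> N)) (s S * b (\<theta> N)) \<epsilon> S - 0\<bar> < \<delta>"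
          using \<theta>(1) elim(2) by (intro K) auto
        then show "deviation (R (\<theta> N)) (s S * b (\<theta> N)) \<epsilon> S < \<delta>" by linarith
      qed
    qed
  qed
  have at_sizes: "\<forall>\<^sub>F N in sequentially. \<forall>S. B * real N \<le> real S \<longrightarrow> Q S"
    if Q: "eventually Q sequentially" for Q :: "nat \<Rightarrow> bool"
  proof -
    obtain S\<^sub>0 where S\<^sub>0: "\<And>S. S\<^sub>0 \<le> S \<Longrightarrow> Q S"
      using Q by (auto simp: eventually_sequentially)
    have "filterlim (\<lambda>N. B * real N) at_top sequentially"
      using pos by (intro filterlim_tendsto_pos_mult_at_top[OF tendsto_const]
          filterlim_real_sequentially) auto
    then have "\<forall>\<^sub>F N in sequentially. real S\<^sub>0 \<le> B * real N"
      by (simp add: filterlim_at_top)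
    then show ?thesis
      by eventually_elim (meson S\<^sub>0 of_nat_le_iff order_trans)
  qed
  show "\<forall>\<^sub>F N in sequentially. \<forall>S. B * real N \<le> real S \<longrightarrow>
      - ln (\<alpha> N) \<le> \<zeta> ^ 4 * c * h * real S * (b (\<theta> N))\<^sup>2 \<longrightarrow> 1 - \<delta> < power (R (\<theta> N)) (\<alpha> N) S"
    if \<zeta>: "\<zeta> < 1"
  proof -
    have "\<forall>\<^sub>F S in sequentially. \<zeta> * h < (s S)\<^sup>2 / real S"
      using \<zeta> pos by (intro order_tendstoD(1)[OF s(2)]) simp
    note size = at_sizes[OF this]
    have "c - \<zeta> * c > 0" using \<zeta> pos by simp
    note rate' = v_rate[OF this]
    have "1 - \<zeta> > 0" using \<zeta> by simp
    from dev_small[OF this] rate' size eventually_gt_at_top[of 0]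
    show ?thesis
    proof eventually_elim
      case (elim N)
      show ?case
      proof (intro allI impI)
        fix S assume S: "B * real N \<le> real S"
          and hyp: "- ln (\<alpha> N) \<le> \<zeta> ^ 4 * c * h * real S * (b (\<theta> N))\<^sup>2"
        have S0: "real S > 0" using S elim(4) pos by (smt (verit) mult_pos_pos of_nat_0_less_iff)
        have sS: "\<zeta> * h * real S < (s S)\<^sup>2"
          using elim(3)[rule_format, OF S] unfolding pos_less_divide_eq[OF S0] .
        moreover have "0 < \<zeta> * h * real S" using S0 pos by simp
        ultimately have "(s S)\<^sup>2 > 0" by linarith
        then have "s S > 0" using s(1)[of S] by (simp add: order_less_le)
        then have sb: "s S * b (\<theta> N) > 0" using b \<theta>(1) by simp
        have "\<zeta> * c < - ln (tail_at S (v N)) / (v N)\<^sup>2"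
          using elim(2) S by (auto simp: abs_less_iff)
        then have "\<zeta> * c * (v N)\<^sup>2 < - ln (tail_at S (v N))"
          unfolding pos_less_divide_eq[OF v2] .
        then have "- ln (\<alpha> N) < - ln (tail_at S (v N))"
          using pos by (simp add: v(2) L_def)
        then have tail: "tail_at S (v N) \<le> \<alpha> N"
          by (intro le_of_neg_ln_ge[OF \<alpha>01(1) tail_nonneg]) simp
        have "L N \<le> (\<zeta> * c) * (\<zeta>\<^sup>2 * (\<zeta> * h * real S) * (b (\<theta> N))\<^sup>2)"
          using hyp by (simp add: L_def mult_ac numeral_eq_Suc)
        then have "(v N)\<^sup>2 \<le> \<zeta>\<^sup>2 * (\<zeta> * h * real S) * (b (\<theta> N))\<^sup>2"
          using pos by (simp add: v(2) pos_divide_le_eq mult_ac)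
        also have "\<dots> \<le> \<zeta>\<^sup>2 * (s S)\<^sup>2 * (b (\<theta> N))\<^sup>2"
          using sS by (intro mult_right_mono mult_left_mono) auto
        also have "\<dots> = ((1 - (1 - \<zeta>)) * (s S * b (\<theta> N)))\<^sup>2"
          by (simp add: power_mult_distrib)
        finally have "v N \<le> (1 - (1 - \<zeta>)) * (s S * b (\<theta> N))"
          by (rule power2_le_imp_le) (intro mult_nonneg_nonneg[OF _ less_imp_le[OF sb]], use pos in simp)
        then have "1 - deviation (R (\<theta> N)) (s S * b (\<theta> N)) (1 - \<zeta>) S \<le> power (R (\<theta> N)) (\<alpha> N) S"
          using R \<theta>(1) sb tail by (intro power_ge_deviation) auto
        then show "1 - \<delta> < power (R (\<theta> N)) (\<alpha> N) S" using elim(1) S by force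
      qed
    qed
  qed
  show "\<forall>\<^sub>F N in sequentially. \<forall>S. B * real N \<le> real S \<longrightarrow>
      \<zeta> ^ 4 * c * h * real S * (b (\<theta> N))\<^sup>2 \<le> - ln (\<alpha> N) \<longrightarrow> power (R (\<theta> N)) (\<alpha> N) S < \<delta>"
    if \<zeta>: "\<zeta> > 1"
  proof -
    have "\<forall>\<^sub>F S in sequentially. (s S)\<^sup>2 / real S < \<zeta> * h"
      using \<zeta> pos by (intro order_tendstoD(2)[OF s(2)]) simp
    note upper = at_sizes[OF this]
    have "\<forall>\<^sub>F S in sequentially. 0 < (s S)\<^sup>2 / real S"
      using pos by (intro order_tendstoD(1)[OF s(2)])
    note lower = at_sizes[OF this]
    have "min c (\<zeta> * c - c) > 0" using \<zeta> pos by simp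
    note rate' = v_rate[OF this]
    have "\<zeta> - 1 > 0" using \<zeta> by simp
    from dev_small[OF this] rate' upper lower eventually_gt_at_top[of 0]
    show ?thesis
    proof eventually_elim
      case (elim N)
      show ?case
      proof (intro allI impI)
        fix S assume S: "B * real N \<le> real S"
          and hyp: "\<zeta> ^ 4 * c * h * real S * (b (\<theta> N))\<^sup>2 \<le> - ln (\<alpha> N)"
        have S0: "real S > 0" using S elim(5) pos by (smt (verit) mult_pos_pos of_nat_0_less_iff)
        have sS: "(s S)\<^sup>2 < \<zeta> * h * real S"
          using elim(3)[rule_format, OF S] unfolding pos_divide_less_eq[OF S0] .
        have "s S > 0"
          using elim(4) S s(1)[of S] by (cases "s S = 0") auto
        then have sb: "s S * b (\<theta> N) > 0" using b \<theta>(1) by simp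
        have "\<bar>- ln (tail_at S (v N)) / (v N)\<^sup>2 - c\<bar> < min c (\<zeta> * c - c)"
          using elim(2) S by blast
        then have "0 < - ln (tail_at S (v N)) / (v N)\<^sup>2"
          "- ln (tail_at S (v N)) / (v N)\<^sup>2 < \<zeta> * c"
          by (auto simp: abs_less_iff)
        then have "0 < - ln (tail_at S (v N))" "- ln (tail_at S (v N)) < \<zeta> * c * (v N)\<^sup>2"
          unfolding pos_less_divide_eq[OF v2] pos_divide_less_eq[OF v2] by simp_all
        then have tail: "\<alpha> N < tail_at S (v N)"
          using pos by (intro less_of_neg_ln_less[OF \<alpha>01(1) tail_nonneg]) (auto simp: v(2) L_def)
        have "((1 + (\<zeta> - 1)) * (s S * b (\<theta> N)))\<^sup>2 = \<zeta>\<^sup>2 * (s S)\<^sup>2 * (b (\<theta> N))\<^sup>2"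
          by (simp add: power_mult_distrib)
        also have "\<dots> \<le> \<zeta>\<^sup>2 * (\<zeta> * h * real S) * (b (\<theta> N))\<^sup>2"
          using sS by (intro mult_right_mono mult_left_mono) auto
        also have "(\<zeta> * c) * (\<zeta>\<^sup>2 * (\<zeta> * h * real S) * (b (\<theta> N))\<^sup>2) \<le> L N"
          using hyp by (simp add: L_def mult_ac numeral_eq_Suc)
        then have "\<zeta>\<^sup>2 * (\<zeta> * h * real S) * (b (\<theta> N))\<^sup>2 \<le> (v N)\<^sup>2"
          using pos by (simp add: v(2) pos_le_divide_eq mult_ac)
        finally have "(1 + (\<zeta> - 1)) * (s S * b (\<theta> N)) \<le> v N"
          by (rule power2_le_imp_le) (rule less_imp_le[OF v(1)])
        then have "power (R (\<theta> N)) (\<alpha> N) S \<le> deviation (R (\<theta> N)) (s S * b (\<theta> N)) (\<zeta> - 1) S"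
          using R \<theta>(1) sb tail by (intro power_le_deviation) auto
        then show "power (R (\<theta> N)) (\<alpha> N) S < \<delta>" using elim(1) S by force
      qed
    qed
  qed
qed

end

text \<open>
  For the lower bound a single size suffices, since a required size has to work for all larger
  sizes as well.
\<close>

lemma required_size_limit:
  fixes e :: ereal
  assumes e: "0 \<le> e"
    and upper: "\<And>A. e < ereal A \<Longrightarrow> \<forall>\<^sub>F N in sequentially. \<forall>S. A * real N \<le> real S \<longrightarrow>
        power_at m n PP\<^sub>0 V (R N) (\<alpha> N) N \<le> power_at m n PP\<^sub>0 U (R N) (\<alpha> N) S"
    and lower: "\<And>A. 0 < A \<Longrightarrow> ereal A < e \<Longrightarrow> \<forall>\<^sub>F N in sequentially.
        power_at m n PP\<^sub>0 U (R N) (\<alpha> N) (nat \<lfloor>A * real N\<rfloor>) < power_at m n PP\<^sub>0 V (R N) (\<alpha> N) N"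
  shows "(\<lambda>N. required_size m n PP\<^sub>0 V U R \<alpha> N / ereal (real N)) \<longlonglongrightarrow> e"
proof (rule order_tendstoI)
  fix a assume "e < a"
  then obtain A' where A': "e < ereal A'" "ereal A' < a" using ereal_dense2 by blast
  then obtain A where A: "e < ereal A" "ereal A < ereal A'" using ereal_dense2 by blast
  have "A > 0" using e A(1) by (metis ereal_less(2) le_less_trans)
  have "(\<lambda>N. A + 2 / real N) \<longlonglongrightarrow> A" by real_asymp
  then have "\<forall>\<^sub>F N in sequentially. A + 2 / real N < A'"
    using A(2) by (intro order_tendstoD(2)) auto
  with upper[OF A(1)] eventually_gt_at_top[of 0]
  show "\<forall>\<^sub>F N in sequentially. required_size m n PP\<^sub>0 V U R \<alpha> N / ereal (real N) < a"
  proof eventually_elim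
    case (elim N)
    define M where "M = nat \<lceil>A * real N\<rceil> + 1"
    have M: "A * real N \<le> real M" "real M \<le> A * real N + 2"
      using \<open>A > 0\<close> unfolding M_def by (simp_all add: of_nat_nat) linarith+
    have "required_size m n PP\<^sub>0 V U R \<alpha> N \<le> ereal (real M)"
      unfolding required_size_def
    proof (rule Inf_lower, intro CollectI exI conjI allI)
      show "1 \<le> M" by (simp add: M_def)
      show "power_at m n PP\<^sub>0 V (R N) (\<alpha> N) N \<le> power_at m n PP\<^sub>0 U (R N) (\<alpha> N) (M + k)" for k
        using elim(1) M(1) by simp
    qed simp
    then have "required_size m n PP\<^sub>0 V U R \<alpha> N / ereal (real N) \<le> ereal (real M) / ereal (real N)"
      using elim(2) by (intro ereal_divide_right_mono) auto
    also have "\<dots> = ereal (real M / real N)" using elim(2) by simp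
    also have "\<dots> \<le> ereal (A + 2 / real N)"
      using elim(2) M(2) by (simp add: field_simps)
    also have "\<dots> < ereal A'" using elim(3) by simp
    finally show ?case using A'(2) by simp
  qed
next
  fix a assume a: "a < e"
  show "\<forall>\<^sub>F N in sequentially. a < required_size m n PP\<^sub>0 V U R \<alpha> N / ereal (real N)"
  proof (cases "a < 0")
    case True
    have "0 \<le> required_size m n PP\<^sub>0 V U R \<alpha> N" for N
      unfolding required_size_def by (rule Inf_greatest) auto
    then have "\<forall>\<^sub>F N in sequentially. 0 \<le> required_size m n PP\<^sub>0 V U R \<alpha> N / ereal (real N)"
      by (intro eventually_mono[OF eventually_gt_at_top[of 0]] zero_le_divide_ereal) auto
    then show ?thesis by eventually_elim (use True in auto)
  next
    case False
    obtain A where A: "a < ereal A" "ereal A < e" using ereal_dense2[OF a] by blast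
    have "A > 0" using False A(1) by (metis ereal_less(2) not_less le_less_trans)
    from lower[OF this A(2)] eventually_gt_at_top[of 0]
    show ?thesis
    proof eventually_elim
      case (elim N)
      have "ereal (A * real N) \<le> required_size m n PP\<^sub>0 V U R \<alpha> N"
        unfolding required_size_def
      proof (rule Inf_greatest, clarify)
        fix M assume "\<forall>k. power_at m n PP\<^sub>0 V (R N) (\<alpha> N) N \<le> power_at m n PP\<^sub>0 U (R N) (\<alpha> N) (M + k)"
        then have "\<not> M \<le> nat \<lfloor>A * real N\<rfloor>"
          using elim(1) by (metis le_Suc_ex not_less)
        then show "ereal (A * real N) \<le> ereal (real M)" by simp linarith
      qed
      then have "ereal (A * real N) / ereal (real N) \<le> required_size m n PP\<^sub>0 V U R \<alpha> N / ereal (real N)"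
        using elim(2) by (intro ereal_divide_right_mono) auto
      moreover have "ereal (A * real N) / ereal (real N) = ereal A" using elim(2) by simp
      ultimately show ?case using A(1) by (metis less_le_trans)
    qed
  qed
qed

theorem theorem1:
  fixes X :: "'a measure"
    and m n :: "nat \<Rightarrow> nat" and \<eta> :: real
    and PP PP\<^sub>0 :: "('a measure \<times> 'a measure) set"
    and PQ\<^sub>0 PQ\<^sub>1 :: "'a measure \<times> 'a measure"
    and U\<^sub>I U\<^sub>I\<^sub>I :: "'a statistic"
    and \<rho> c\<^sub>I c\<^sub>I\<^sub>I :: real
    and b\<^sub>I :: "'a measure \<times> 'a measure \<Rightarrow> real" and b\<^sub>I\<^sub>I :: "nat \<Rightarrow> real"
    and \<theta> \<gamma> \<Lambda> :: "nat \<Rightarrow> real" and e :: ereal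
  assumes sizes: "\<And>N. m N + n N = N"
    and eta: "0 < \<eta>" "\<eta> < 1" "(\<lambda>N. real (m N) / real N) \<longlonglongrightarrow> \<eta>"
    and model: "\<And>P Q. (P, Q) \<in> PP \<Longrightarrow>
          prob_space P \<and> prob_space Q \<and> sets P = sets X \<and> sets Q = sets X"
    and null: "PP\<^sub>0 \<subseteq> PP"
    and fixed_measures: "PQ\<^sub>0 \<in> PP\<^sub>0" "PQ\<^sub>1 \<in> PP - PP\<^sub>0"
    and alternatives: "\<And>t. 0 < t \<Longrightarrow> t < 1 \<Longrightarrow> alternative PQ\<^sub>0 PQ\<^sub>1 t \<in> PP - PP\<^sub>0"
    and statistics: "is_statistic X m n U\<^sub>I" "is_statistic X m n U\<^sub>I\<^sub>I"
    and rho: "1 \<le> \<rho>" "\<rho> \<le> 2"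
    and I1: "c\<^sub>I > 0"
      "\<And>w. (\<And>N. w N > 0) \<Longrightarrow> w \<longlonglongrightarrow> 0 \<Longrightarrow>
         filterlim (\<lambda>N. real N * (w N)\<^sup>2) at_top sequentially \<Longrightarrow>
         tail_rate m n PP\<^sub>0 U\<^sub>I w c\<^sub>I"
    and I2: "\<And>t. 0 < t \<Longrightarrow> t < 1 \<Longrightarrow> b\<^sub>I (alternative PQ\<^sub>0 PQ\<^sub>1 t) > 0"
      "\<And>t \<epsilon>. (\<And>N. 0 < t N \<and> t N < 1) \<Longrightarrow> t \<longlonglongrightarrow> 0 \<Longrightarrow>
         filterlim (\<lambda>N. real N * t N powr \<rho>) at_top sequentially \<Longrightarrow> \<epsilon> > 0 \<Longrightarrow>
         (\<lambda>N. \<P>(x in sample_law m n (alternative PQ\<^sub>0 PQ\<^sub>1 (t N)) N.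
            \<bar>U\<^sub>I N x / (sqrt (real (m N) * real (n N) / real N)
                * b\<^sub>I (alternative PQ\<^sub>0 PQ\<^sub>1 (t N))) - 1\<bar> \<ge> \<epsilon>)) \<longlonglongrightarrow> 0"
    and theta: "\<And>N. 0 < \<theta> N \<and> \<theta> N < 1" "\<theta> \<longlonglongrightarrow> 0"
      "filterlim (\<lambda>N. real N * \<theta> N powr \<rho>) at_top sequentially"
    and II1: "\<And>N. N \<ge> 2 \<Longrightarrow> 1 \<le> \<gamma> N \<and> \<gamma> N < \<Lambda> N \<and> \<Lambda> N \<le> real N"
      "(\<lambda>N. \<gamma> N / \<Lambda> N) \<longlonglongrightarrow> 0"
      "c\<^sub>I\<^sub>I > 0"
      "\<And>w. (\<And>N. w N > 0) \<Longrightarrow> (\<lambda>N. real N * (w N)\<^sup>2 / \<Lambda> N) \<longlonglongrightarrow> 0 \<Longrightarrow>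
         filterlim (\<lambda>N. real N * (w N)\<^sup>2 / \<gamma> N) at_top sequentially \<Longrightarrow>
         tail_rate m n PP\<^sub>0 U\<^sub>I\<^sub>I w c\<^sub>I\<^sub>I"
    and II2: "\<And>N. b\<^sub>I\<^sub>I N > 0"
      "\<And>\<epsilon>. \<epsilon> > 0 \<Longrightarrow>
         (\<lambda>N. \<P>(x in sample_law m n (alternative PQ\<^sub>0 PQ\<^sub>1 (\<theta> N)) N.
            \<bar>U\<^sub>I\<^sub>I N x / b\<^sub>I\<^sub>I N - 1\<bar> \<ge> \<epsilon>)) \<longlonglongrightarrow> 0"
    and level: "\<exists>\<alpha>\<in>levels_star m n PP\<^sub>0 U\<^sub>I\<^sub>I (\<lambda>N. alternative PQ\<^sub>0 PQ\<^sub>1 (\<theta> N)).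
         (\<lambda>N. ln (\<alpha> N) / \<Lambda> N) \<longlonglongrightarrow> 0 \<and> filterlim (\<lambda>N. ln (\<alpha> N) / \<gamma> N) at_bot sequentially"
    and ratio: "(\<lambda>N. ereal (c\<^sub>I\<^sub>I * (b\<^sub>I\<^sub>I N)\<^sup>2 /
         (c\<^sub>I * (real (m N) * real (n N) / real N) * (b\<^sub>I (alternative PQ\<^sub>0 PQ\<^sub>1 (\<theta> N)))\<^sup>2)))
         \<longlonglongrightarrow> e"
  shows "has_intermediate_efficiency m n PP\<^sub>0 U\<^sub>I\<^sub>I U\<^sub>I
           (\<lambda>N. alternative PQ\<^sub>0 PQ\<^sub>1 (\<theta> N)) e"
proof -
  define R where "R t = alternative PQ\<^sub>0 PQ\<^sub>1 t" for t
  have adm: "admissible X PQ" if "PQ \<in> PP" for PQ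
    using model[of "fst PQ" "snd PQ"] that by (simp add: admissible_def)
  have R: "admissible X (R t)" if "0 < t" "t < 1" for t
    using alternatives[OF that] by (auto simp: R_def intro: adm)
  interpret I: test_statistic X m n PP\<^sub>0 U\<^sub>I
    using fixed_measures null statistics by unfold_locales (auto intro: adm)
  interpret II: test_statistic X m n PP\<^sub>0 U\<^sub>I\<^sub>I
    using fixed_measures null statistics by unfold_locales (auto intro: adm)
  define s where "s N = sqrt (real (m N) * real (n N) / real N)" for N
  define h where "h = \<eta> * (1 - \<eta>)"
  have h: "h > 0" using eta by (simp add: h_def)
  have s: "(s N)\<^sup>2 = real (m N) * real (n N) / real N" "s N \<ge> 0" for N
    by (auto simp: s_def)
  have s_lim: "(\<lambda>N. (s N)\<^sup>2 / real N) \<longlonglongrightarrow> h"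
  proof (rule Lim_transform_eventually)
    show "(\<lambda>N. real (m N) / real N * (1 - real (m N) / real N)) \<longlonglongrightarrow> h"
      unfolding h_def by (intro tendsto_intros eta)
    show "\<forall>\<^sub>F N in sequentially.
        real (m N) / real N * (1 - real (m N) / real N) = (s N)\<^sup>2 / real N"
      using eventually_gt_at_top[of 0]
    proof eventually_elim
      case (elim N)
      have "real (n N) = real N - real (m N)" using sizes[of N] by linarith
      then have "1 - real (m N) / real N = real (n N) / real N"
        using elim by (simp add: diff_divide_distrib)
      then show ?case by (simp add: s)
    qed
  qed
  have dev_II: "(\<lambda>N. II.deviation (R (\<theta> N)) (b\<^sub>I\<^sub>I N) \<epsilon> N) \<longlonglongrightarrow> 0" if "\<epsilon> > 0" for \<epsilon>
    using II2(2)[OF that] by (simp add: R_def)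
  have dev_I: "\<exists>\<tau>>0. \<exists>K. \<forall>S t. 0 < t \<longrightarrow> t < \<tau> \<longrightarrow> K \<le> real S * t powr \<rho> \<longrightarrow>
      \<bar>I.deviation (R t) (s S * b\<^sub>I (R t)) \<epsilon> S - 0\<bar> < \<delta>" if "\<epsilon> > 0" "\<delta> > 0" for \<epsilon> \<delta>
    using rho that I2(2) unfolding R_def s_def by (intro uniform_of_sequences) auto
  have tail_II: "(\<lambda>N. - ln (II.tail_at N (v N)) / (v N)\<^sup>2) \<longlonglongrightarrow> c\<^sub>I\<^sub>I"
    if v: "\<And>N. v N > 0" "(\<lambda>N. (v N)\<^sup>2 / \<Lambda> N) \<longlonglongrightarrow> 0"
      "filterlim (\<lambda>N. (v N)\<^sup>2 / \<gamma> N) at_top sequentially" for v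
  proof (rule II.tail_rate_threshold[OF v(1)])
    define w where "w N = (if N = 0 then 1 else v N / sqrt (real N))" for N :: nat
    have w: "\<forall>\<^sub>F N in sequentially. real N * (w N)\<^sup>2 = (v N)\<^sup>2"
      using eventually_gt_at_top[of 0] by eventually_elim (simp add: w_def power_divide)
    have "tail_rate m n PP\<^sub>0 U\<^sub>I\<^sub>I w c\<^sub>I\<^sub>I"
    proof (rule II1(4))
      show "w N > 0" for N using v(1) by (simp add: w_def)
      show "(\<lambda>N. real N * (w N)\<^sup>2 / \<Lambda> N) \<longlonglongrightarrow> 0"
        by (rule Lim_transform_eventually[OF v(2)]) (use w in eventually_elim, simp)
      have "\<forall>\<^sub>F N in sequentially. (v N)\<^sup>2 / \<gamma> N = real N * (w N)\<^sup>2 / \<gamma> N"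
        using w by eventually_elim simp
      then show "filterlim (\<lambda>N. real N * (w N)\<^sup>2 / \<gamma> N) at_top sequentially"
        using v(3) by (rule filterlim_cong[THEN iffD1, OF refl refl])
    qed
    then show "tail_rate m n PP\<^sub>0 U\<^sub>I\<^sub>I (\<lambda>N. if N = 0 then 1 else v N / sqrt (real N)) c\<^sub>I\<^sub>I"
      by (simp add: w_def[abs_def])
  qed
  have pos: "\<forall>\<^sub>F N in sequentially. 0 < \<gamma> N \<and> 0 < \<Lambda> N"
    using eventually_ge_at_top[of 2] by eventually_elim (use II1(1) in force)
  obtain \<alpha>\<^sub>0 where \<alpha>\<^sub>0: "\<alpha>\<^sub>0 \<in> levels_star m n PP\<^sub>0 U\<^sub>I\<^sub>I (\<lambda>N. R (\<theta> N))"
    "(\<lambda>N. ln (\<alpha>\<^sub>0 N) / \<Lambda> N) \<longlonglongrightarrow> 0" "filterlim (\<lambda>N. ln (\<alpha>\<^sub>0 N) / \<gamma> N) at_bot sequentially"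
    using level unfolding R_def by blast
  have R\<theta>: "admissible X (R (\<theta> N))" for N using R theta(1) by blast
  have range: "(\<lambda>N. (\<kappa> * b\<^sub>I\<^sub>I N)\<^sup>2 / \<Lambda> N) \<longlonglongrightarrow> 0"
    "filterlim (\<lambda>N. (\<kappa> * b\<^sub>I\<^sub>I N)\<^sup>2 / \<gamma> N) at_top sequentially" if "\<kappa> > 0" for \<kappa>
    by (rule II.concentration_point_in_range[OF R\<theta> II2(1) dev_II II1(3) tail_II pos \<alpha>\<^sub>0 that];
        assumption)+
  define \<beta> where "\<beta> N = b\<^sub>I (R (\<theta> N))" for N
  have \<beta>: "\<beta> N > 0" for N using I2(1) theta(1) by (simp add: \<beta>_def R_def)
  have "(\<lambda>N. required_size m n PP\<^sub>0 U\<^sub>I\<^sub>I U\<^sub>I (\<lambda>N. R (\<theta> N)) \<alpha> N / ereal (real N)) \<longlonglongrightarrow> e"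
    if \<alpha>: "\<alpha> \<in> levels_star m n PP\<^sub>0 U\<^sub>I\<^sub>I (\<lambda>N. R (\<theta> N))" for \<alpha>
  proof -
    have lev: "\<alpha> \<in> levels" using \<alpha> by (simp add: levels_star_def)
    \<comment> \<open>The size at which the first test has the critical value and the statistic in balance,
        relative to \<open>N\<close>.\<close>
    define q where "q N = - ln (\<alpha> N) / (c\<^sub>I * h * real N * (\<beta> N)\<^sup>2)" for N
    \<comment> \<open>\<open>q\<close> differs from the given ratio by two factors tending to \<open>1\<close>.\<close>
    have q_lim: "(\<lambda>N. ereal (q N)) \<longlonglongrightarrow> e"
    proof -
      have "(\<lambda>N. - ln (\<alpha> N) / (b\<^sub>I\<^sub>I N)\<^sup>2) \<longlonglongrightarrow> c\<^sub>I\<^sub>I"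
      proof (rule II.levels_star_log_asymptotics[OF R\<theta> II2(1) dev_II II1(3) _ \<alpha>])
        fix \<kappa> :: real assume "\<kappa> > 0"
        then show "(\<lambda>N. - ln (II.tail_at N (\<kappa> * b\<^sub>I\<^sub>I N)) / (\<kappa> * b\<^sub>I\<^sub>I N)\<^sup>2) \<longlonglongrightarrow> c\<^sub>I\<^sub>I"
          using II2(1) by (intro tail_II range) auto
      qed
      then have "(\<lambda>N. - ln (\<alpha> N) / (b\<^sub>I\<^sub>I N)\<^sup>2 / c\<^sub>I\<^sub>I * ((s N)\<^sup>2 / real N / h)) \<longlonglongrightarrow> c\<^sub>I\<^sub>I / c\<^sub>I\<^sub>I * (h / h)"
        using II1(3) h by (intro tendsto_intros s_lim) auto
      then have "(\<lambda>N. ereal (- ln (\<alpha> N) / (b\<^sub>I\<^sub>I N)\<^sup>2 / c\<^sub>I\<^sub>I * ((s N)\<^sup>2 / real N / h))) \<longlonglongrightarrow> 1"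
        using II1(3) h by (simp add: one_ereal_def)
      from tendsto_mult_ereal[OF ratio this]
      have "(\<lambda>N. ereal (c\<^sub>I\<^sub>I * (b\<^sub>I\<^sub>I N)\<^sup>2 / (c\<^sub>I * (s N)\<^sup>2 * (\<beta> N)\<^sup>2)) *
          ereal (- ln (\<alpha> N) / (b\<^sub>I\<^sub>I N)\<^sup>2 / c\<^sub>I\<^sub>I * ((s N)\<^sup>2 / real N / h))) \<longlonglongrightarrow> e"
        by (simp add: s \<beta>_def R_def)
      moreover have "\<forall>\<^sub>F N in sequentially. 0 < (s N)\<^sup>2 / real N"
        by (rule order_tendstoD(1)[OF s_lim h])
      then have "\<forall>\<^sub>F N in sequentially. ereal (c\<^sub>I\<^sub>I * (b\<^sub>I\<^sub>I N)\<^sup>2 / (c\<^sub>I * (s N)\<^sup>2 * (\<beta> N)\<^sup>2)) *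
          ereal (- ln (\<alpha> N) / (b\<^sub>I\<^sub>I N)\<^sup>2 / c\<^sub>I\<^sub>I * ((s N)\<^sup>2 / real N / h)) = ereal (q N)"
      proof eventually_elim
        case (elim N)
        then have "s N \<noteq> 0" "real N \<noteq> 0" by (metis div_0 less_irrefl zero_power2, metis div_by_0 less_irrefl)
        then show ?case
          using II1(3) I1(1) h II2(1)[of N] \<beta>[of N] by (simp add: q_def field_simps)
      qed
      ultimately show ?thesis by (rule Lim_transform_eventually)
    qed
    have "ln (\<alpha> N) < 0" for N using lev by (simp add: levels_def)
    then have "0 \<le> q N" for N
      unfolding q_def using I1(1) h by (intro divide_nonneg_nonneg) (auto simp: less_imp_le)
    then have e: "0 \<le> e"
      by (intro tendsto_lowerbound[OF q_lim]) auto
    have bal: "A * (c\<^sub>I * h * real N * (\<beta> N)\<^sup>2) \<le> - ln (\<alpha> N) \<longleftrightarrow> A \<le> q N"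
      "- ln (\<alpha> N) \<le> A * (c\<^sub>I * h * real N * (\<beta> N)\<^sup>2) \<longleftrightarrow> q N \<le> A" if "N > 0" for A N
    proof -
      have "c\<^sub>I * h * real N * (\<beta> N)\<^sup>2 > 0" using that I1(1) h \<beta>[of N] by simp
      then show "A * (c\<^sub>I * h * real N * (\<beta> N)\<^sup>2) \<le> - ln (\<alpha> N) \<longleftrightarrow> A \<le> q N"
        "- ln (\<alpha> N) \<le> A * (c\<^sub>I * h * real N * (\<beta> N)\<^sup>2) \<longleftrightarrow> q N \<le> A"
        unfolding q_def by (simp_all only: pos_le_divide_eq pos_divide_le_eq)
    qed
    have b\<^sub>I_pos: "b\<^sub>I (R t) > 0" if "0 < t" "t < 1" for t
      using I2(1)[OF that] by (simp add: R_def)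
    show ?thesis
    proof (rule required_size_limit[OF e])
      fix A assume "e < ereal A"
      then obtain A' where A': "e < ereal A'" "A' < A" using ereal_dense2 by force
      have "A' > 0" using e A'(1) by (metis ereal_less(2) le_less_trans)
      with A' have "A > 0" by simp
      \<comment> \<open>The gap between \<open>A\<close> and \<open>e\<close> is spent on the margin \<open>\<zeta> ^ 4\<close>.\<close>
      define \<zeta> where "\<zeta> = root 4 (A' / A)"
      have \<zeta>: "0 < \<zeta>" "\<zeta> < 1" "\<zeta> ^ 4 * A = A'"
        using A'(2) \<open>A' > 0\<close> by (auto simp: \<zeta>_def)
      have "limsup (\<lambda>N. ereal (II.power (R (\<theta> N)) (\<alpha> N) N)) < 1"
        using \<alpha> by (simp add: levels_star_def)
      then obtain p where p: "limsup (\<lambda>N. ereal (II.power (R (\<theta> N)) (\<alpha> N) N)) < ereal p" "ereal p < 1"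
        using ereal_dense2 by blast
      have "1 - p > 0" using p(2) by simp
      have "\<forall>\<^sub>F N in sequentially. q N < A'"
        using order_tendstoD(2)[OF q_lim A'(1)] by simp
      moreover have "\<forall>\<^sub>F N in sequentially. \<forall>S. A * real N \<le> real S \<longrightarrow>
          - ln (\<alpha> N) \<le> \<zeta> ^ 4 * c\<^sub>I * h * real S * (b\<^sub>I (R (\<theta> N)))\<^sup>2 \<longrightarrow>
          1 - (1 - p) < I.power (R (\<theta> N)) (\<alpha> N) S"
        by (rule I.power_near_1[where \<rho> = \<rho> and s = s and b = "\<lambda>t. b\<^sub>I (R t)"])
          (fact theta R b\<^sub>I_pos s s_lim I1 h \<open>A > 0\<close> \<open>1 - p > 0\<close> \<zeta> dev_I lev)+
      ultimately show "\<forall>\<^sub>F N in sequentially. \<forall>S. A * real N \<le> real S \<longrightarrow>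
          II.power (R (\<theta> N)) (\<alpha> N) N \<le> I.power (R (\<theta> N)) (\<alpha> N) S"
        using Limsup_lessD[OF p(1)] eventually_gt_at_top[of 0]
      proof eventually_elim
        case (elim N)
        show ?case
        proof (intro allI impI)
          fix S assume S: "A * real N \<le> real S"
          have "- ln (\<alpha> N) \<le> A' * (c\<^sub>I * h * real N * (\<beta> N)\<^sup>2)"
            using elim(1,4) by (simp add: bal)
          also have "\<dots> = \<zeta> ^ 4 * c\<^sub>I * h * (A * real N) * (\<beta> N)\<^sup>2"
            by (simp add: \<zeta>(3)[symmetric])
          also have "\<dots> \<le> \<zeta> ^ 4 * c\<^sub>I * h * real S * (\<beta> N)\<^sup>2"
            using S \<zeta>(1) I1(1) h by (intro mult_right_mono mult_left_mono) auto
          finally have "1 - (1 - p) < I.power (R (\<theta> N)) (\<alpha> N) S"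
            using elim(2) S by (auto simp: \<beta>_def)
          then show "II.power (R (\<theta> N)) (\<alpha> N) N \<le> I.power (R (\<theta> N)) (\<alpha> N) S"
            using elim(3) by simp
        qed
      qed
    next
      fix A assume A: "0 < A" "ereal A < e"
      then obtain A' where A': "A < A'" "ereal A' < e" using ereal_dense2 by force
      define \<zeta> where "\<zeta> = root 4 (A' / A)"
      have \<zeta>: "0 < \<zeta>" "1 < \<zeta>" "\<zeta> ^ 4 * A = A'"
        using A'(1) A(1) by (auto simp: \<zeta>_def)
      have "0 < liminf (\<lambda>N. ereal (II.power (R (\<theta> N)) (\<alpha> N) N))"
        using \<alpha> by (simp add: levels_star_def)
      then obtain p where p: "0 < ereal p" "ereal p < liminf (\<lambda>N. ereal (II.power (R (\<theta> N)) (\<alpha> N) N))"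
        using ereal_dense2 by blast
      have "0 < p" using p(1) by simp
      \<comment> \<open>Rounding \<open>A * N\<close> down costs at most a factor \<open>2\<close> once \<open>A * N \<ge> 2\<close>.\<close>
      have "0 < A / 2" using A(1) by simp
      have "\<forall>\<^sub>F N in sequentially. A' < q N"
        using order_tendstoD(1)[OF q_lim A'(2)] by simp
      moreover have "\<forall>\<^sub>F N in sequentially. \<forall>S. A / 2 * real N \<le> real S \<longrightarrow>
          \<zeta> ^ 4 * c\<^sub>I * h * real S * (b\<^sub>I (R (\<theta> N)))\<^sup>2 \<le> - ln (\<alpha> N) \<longrightarrow>
          I.power (R (\<theta> N)) (\<alpha> N) S < p"
        by (rule I.power_near_0[where \<rho> = \<rho> and s = s and b = "\<lambda>t. b\<^sub>I (R t)"])
          (fact theta R b\<^sub>I_pos s s_lim I1 h \<open>0 < A / 2\<close> \<open>0 < p\<close> \<zeta> dev_I lev)+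
      ultimately show "\<forall>\<^sub>F N in sequentially.
          I.power (R (\<theta> N)) (\<alpha> N) (nat \<lfloor>A * real N\<rfloor>) < II.power (R (\<theta> N)) (\<alpha> N) N"
        using less_LiminfD[OF p(2)] eventually_ge_at_top[of "nat \<lceil>2 / A\<rceil> + 1"]
      proof eventually_elim
        case (elim N)
        define S where "S = nat \<lfloor>A * real N\<rfloor>"
        have "2 / A \<le> real N" "N > 0" using elim(4) by linarith+
        then have "2 \<le> A * real N" using A(1) by (simp add: field_simps)
        then have S: "A / 2 * real N \<le> real S" "real S \<le> A * real N"
          unfolding S_def by (simp_all add: of_nat_nat) linarith+
        have "\<zeta> ^ 4 * c\<^sub>I * h * real S * (\<beta> N)\<^sup>2 \<le> \<zeta> ^ 4 * c\<^sub>I * h * (A * real N) * (\<beta> N)\<^sup>2"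
          using S \<zeta>(1) I1(1) h by (intro mult_right_mono mult_left_mono) auto
        also have "\<dots> = A' * (c\<^sub>I * h * real N * (\<beta> N)\<^sup>2)"
          by (simp add: \<zeta>(3)[symmetric])
        also have "\<dots> \<le> - ln (\<alpha> N)"
          using elim(1) \<open>N > 0\<close> by (simp add: bal)
        finally have "I.power (R (\<theta> N)) (\<alpha> N) S < p"
          using elim(2) S by (auto simp: \<beta>_def)
        then show ?case using elim(3) by (simp add: S_def)
      qed
    qed
  qed
  then show ?thesis
    unfolding has_intermediate_efficiency_def R_def[symmetric] using \<alpha>\<^sub>0(1) by blast
qed

end
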